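(* Let $\Omega\subset\mathbb{R}^d$ be open and nonempty, let $p\in(0,1]$, and suppose $\psi\in L^p(\mathbb{R}^d)$ is compactly supported and satisfies $\|\lambda P\psi(b\,\cdot)-1\|_{L^p(\mathcal{C})}<1$ for some $\lambda\in\mathbb{C}$. Then for all $f\in L^p(\Omega)$, $$\|f\|_{L^p(\Omega)}\approx\inf\left\{\|c\|_{\ell^p(\mathbb{Z}_+\times\mathbb{Z}^d)}:c\in\ell^p(\mathbb{Z}_+\times\mathbb{Z}^d),\ f=Sc\ \text{and $c$ is adapted to $\Omega$ and $\psi$}\right\}.$$
   Context: Fix a dimension $d\in\mathbb{N}$. Functions and sequences are complex valued. $\mathbb{Z}_+=\{j\in\mathbb{Z}:j>0\}$, $\mathcal{C}=[0,1)^d$. Fix invertible real $d\times d$ matrices $a_j$ ($j\in\mathbb{Z}_+$) with $\|a_j^{-1}\|\to0$ as $j\to\infty$ (operator norm), and an invertible real $d\times d$ matrix $b$. For measurable $E\subset\mathbb{R}^d$, $\|f\|_{L^p(E)}=(\int_E|f|^p\,dx)^{1/p}$. Functions in $L^p(\Omega)$ are regarded as functions on $\mathbb{R}^d$ by extending them by zero. $\ell^p(\mathbb{Z}_+\times\mathbb{Z}^d)$ is the space of sequences $c=\{c_{j,k}\}_{j>0,k\in\mathbb{Z}^d}$ with $\|c\|_{\ell^p(\mathbb{Z}_+\times\mathbb{Z}^d)}=(\sum_{j>0}\sum_{k}|c_{j,k}|^p)^{1/p}<\infty$. $\psi_{j,k}(x)=|\det a_j|^{1/p}\psi(a_jx-bk)$,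 and $Sc=\sum_{j>0}\sum_{k\in\mathbb{Z}^d}c_{j,k}\psi_{j,k}$ (the series converges absolutely a.e. to a function in $L^p(\mathbb{R}^d)$ for $c\in\ell^p(\mathbb{Z}_+\times\mathbb{Z}^d)$). A sequence $c=\{c_{j,k}\}_{j>0,k\in\mathbb{Z}^d}$ is adapted to $\Omega$ and $\psi$ if $\mathrm{spt}(\psi_{j,k})\subset\Omega$ whenever $c_{j,k}\ne0$, where $\mathrm{spt}$ denotes the (closed, essential) support. (This ensures $Sc=0$ on the complement of $\Omega$.) Periodization: $P\psi(x)=|\det b|\sum_{k\in\mathbb{Z}^d}\psi(x-bk)$, which converges absolutely a.e.; $P\psi(b\,\cdot)$ denotes $x\mapsto(P\psi)(bx)$, which belongs to $L^p(\mathcal{C})$. $A(f)\approx B(f)$ means there are constants $C_1,C_2>0$, depending only on $\psi$, $b$ and $p$ (not on $f$ or $\Omega$), with $C_1A(f)\le B(f)\le C_2A(f)$. *)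

theory Defs
  imports "HOL-Analysis.Analysis"
begin

text \<open>
  Elements of \<open>L\<^sup>p(E)\<close> are represented by functions on the whole space whose values off \<open>E\<close> are
  irrelevant; equality in \<open>L\<^sup>p\<close> is equality almost everywhere.
  For \<open>p > 0\<close> we have \<open>0 powr p = 0\<close>, so \<open>powr\<close> is the usual power of a nonnegative real.
\<close>

definition Lp_space :: "real \<Rightarrow> (real ^ 'd) set \<Rightarrow> (real ^ 'd \<Rightarrow> complex) set" where
  "Lp_space p E = {f. set_borel_measurable lebesgue E f \<and>
                      set_integrable lebesgue E (\<lambda>x. norm (f x) powr p)}"

definition Lp_norm :: "real \<Rightarrow> (real ^ 'd) set \<Rightarrow> (real ^ 'd \<Rightarrow> complex) \<Rightarrow> real" where
  "Lp_norm p E f = (LINT x:E|lebesgue. norm (f x) powr p) powr (1 / p)"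

definition zero_extension :: "(real ^ 'd) set \<Rightarrow> (real ^ 'd \<Rightarrow> complex) \<Rightarrow> real ^ 'd \<Rightarrow> complex" where
  "zero_extension E f = (\<lambda>x. if x \<in> E then f x else 0)"

definition ess_support :: "(real ^ 'd \<Rightarrow> complex) \<Rightarrow> (real ^ 'd) set" where
  "ess_support f = - \<Union>{U. open U \<and> (AE x in lebesgue. x \<in> U \<longrightarrow> f x = 0)}"

definition unit_cube :: "(real ^ 'd) set" where
  "unit_cube = {x. \<forall>i. 0 \<le> x $ i \<and> x $ i < 1}"

definition lattice_point :: "int ^ 'd \<Rightarrow> real ^ 'd" where
  "lattice_point k = (\<chi> i. of_int (k $ i))"

definition periodization ::
    "real ^ 'd ^ 'd \<Rightarrow> (real ^ 'd \<Rightarrow> complex) \<Rightarrow> real ^ 'd \<Rightarrow> complex" where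
  "periodization b \<psi> x =
     of_real \<bar>det b\<bar> * (\<Sum>\<^sub>\<infinity>k\<in>UNIV. \<psi> (x - b *v lattice_point k))"

text \<open>
  Scales are the positive natural numbers: the index set is \<open>{0<..} \<times> UNIV\<close>, and the values of
  \<open>a\<close> and \<open>c\<close> at scale \<open>0\<close> are never used.
\<close>

definition lp_space :: "real \<Rightarrow> (nat \<Rightarrow> int ^ 'd \<Rightarrow> complex) set" where
  "lp_space p = {c. (\<lambda>(j, k). norm (c j k) powr p) summable_on ({0<..} \<times> UNIV)}"

definition lp_norm :: "real \<Rightarrow> (nat \<Rightarrow> int ^ 'd \<Rightarrow> complex) \<Rightarrow> real" where
  "lp_norm p c = (\<Sum>\<^sub>\<infinity>(j, k)\<in>{0<..} \<times> UNIV. norm (c j k) powr p) powr (1 / p)"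

definition affine_function ::
    "real \<Rightarrow> (nat \<Rightarrow> real ^ 'd ^ 'd) \<Rightarrow> real ^ 'd ^ 'd \<Rightarrow> (real ^ 'd \<Rightarrow> complex) \<Rightarrow>
     nat \<Rightarrow> int ^ 'd \<Rightarrow> real ^ 'd \<Rightarrow> complex" where
  "affine_function p a b \<psi> j k x =
     of_real (\<bar>det (a j)\<bar> powr (1 / p)) * \<psi> (a j *v x - b *v lattice_point k)"

text \<open>
  Over the complex numbers \<open>infsum\<close> is the sum of an absolutely convergent family.
\<close>

definition synthesis ::
    "real \<Rightarrow> (nat \<Rightarrow> real ^ 'd ^ 'd) \<Rightarrow> real ^ 'd ^ 'd \<Rightarrow> (real ^ 'd \<Rightarrow> complex) \<Rightarrow>
     (nat \<Rightarrow> int ^ 'd \<Rightarrow> complex) \<Rightarrow> real ^ 'd \<Rightarrow> complex" where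
  "synthesis p a b \<psi> c x =
     (\<Sum>\<^sub>\<infinity>(j, k)\<in>{0<..} \<times> UNIV. c j k * affine_function p a b \<psi> j k x)"

definition adapted ::
    "real \<Rightarrow> (nat \<Rightarrow> real ^ 'd ^ 'd) \<Rightarrow> real ^ 'd ^ 'd \<Rightarrow> (real ^ 'd) set \<Rightarrow>
     (real ^ 'd \<Rightarrow> complex) \<Rightarrow> (nat \<Rightarrow> int ^ 'd \<Rightarrow> complex) \<Rightarrow> bool" where
  "adapted p a b \<Omega> \<psi> c \<longleftrightarrow>
     (\<forall>j>0. \<forall>k. c j k \<noteq> 0 \<longrightarrow> ess_support (affine_function p a b \<psi> j k) \<subseteq> \<Omega>)"

end

theory Submission
  imports Defs
begin

text \<open>
  For \<open>p \<le> 1\<close> the \<open>p\<close>-th powers of the quasi-norms are subadditive, so the lower bound is immediate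
  and everything can be done with the masses \<open>\<integral>|f|\<^sup>p\<close> and \<open>\<Sum>|c|\<^sup>p\<close>.

  For the upper bound, subadditivity reduces the approximation of \<open>f\<close> to indicator functions of
  compact sets \<open>K \<subseteq> \<Omega>\<close>. With \<open>T = a\<^sub>j\<^sup>-\<^sup>1b\<close> for a fine scale \<open>j\<close>, let \<open>I\<close> be the set of lattice cells meeting
  \<open>T\<^sup>-\<^sup>1K\<close> and let \<open>c\<close> be constant on \<open>{j} \<times> I\<close>. On the cells of \<open>I\<close>, \<open>Sc\<close> agrees with a multiple of the rescaled
  periodization \<open>P\<psi>\<close>, up to an error supported near the boundary of \<open>K\<close>, whose mass vanishes as \<open>j\<close>
  grows; so the mass of \<open>1\<^sub>K - Sc\<close> is at most \<open>\<parallel>\<lambda>P\<psi>(b\<cdot>) - 1\<parallel>\<^sup>p|K|\<close> up to an arbitrarily small error.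
  Hence every \<open>f\<close> can be approximated with a relative error bounded away from 1, and iterating on
  the remainder gives \<open>f = Sc\<close> by a geometric series.
\<close>

section \<open>The quasi-norms as extended integrals\<close>

text \<open>The constants may depend neither on \<Omega> nor on the matrices \<open>a j\<close>. At
  scale \<open>j\<close> a cell has volume |det b| / |det (a j)|, while the coefficient that cancels
  the normalisation of the atoms has p-th power |\<mu>|^p / |det (a j)|; so the coefficient mass per
  unit volume of cells is C = |\<mu>|^p / |det b| at every scale. Apart from determinants, the
  matrices enter only through the existence of a fine enough scale. The p-th power of the quasi-norm
  is exactly additive over disjoint supports, so the relative error t < 1 and C pass from indicators
  to simple functions without loss, although the approximants may overlap and are merely
  subadditive. The boundary of K may have positive measure. The boundary error is therefore
  controlled by an open V between K and \<Omega> with small V - K, fixed before the scale. Additive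
  errors are carried along as an arbitrary \<epsilon> and become relative only at the end, with (1 +
  t) / 2 < 1 in place of t. Adaptedness keeps the remainder zero off \<Omega>, which is what permits
  iterating.\<close>

lemma powr_add_le_add_powr:
  fixes x y p :: real
  assumes "0 < p" "p \<le> 1" "0 \<le> x" "0 \<le> y"
  shows "(x + y) powr p \<le> x powr p + y powr p"
proof (cases "x + y = 0")
  case True
  then show ?thesis using assms by auto
next
  case False
  define s where "s = x + y"
  have s: "s > 0" using False assms by (auto simp: s_def)
  \<comment> \<open>Dividing by \<open>s\<close> puts both summands into [0,1], where a power
    \<open>p \<le> 1\<close> does not decrease them.\<close>
  have le: "u \<le> u powr p" if "0 \<le> u" "u \<le> 1" for u :: real
  proof (cases "u = 0")
    case False
    then show ?thesis using that assms powr_mono'[of p 1 u] by auto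
  qed auto
  have "1 = (x + y) / s" using s unfolding s_def by simp
  also have "\<dots> = x / s + y / s" by (simp add: add_divide_distrib)
  also have "\<dots> \<le> (x / s) powr p + (y / s) powr p"
    using s assms by (intro add_mono le) (auto simp: s_def field_simps)
  also have "\<dots> = (x powr p + y powr p) / s powr p"
    using s assms by (simp add: powr_divide add_divide_distrib)
  finally show ?thesis using s by (simp add: s_def field_simps)
qed

lemma sum_powr_le:
  fixes t :: "'i \<Rightarrow> real"
  assumes "0 < p" "p \<le> 1" "\<And>i. i \<in> F \<Longrightarrow> 0 \<le> t i"
  shows "(\<Sum>i\<in>F. t i) powr p \<le> (\<Sum>i\<in>F. t i powr p)"
  using assms(3)
proof (induction F rule: infinite_finite_induct)
  case (insert i F)
  have "(t i + (\<Sum>i\<in>F. t i)) powr p \<le> t i powr p + (\<Sum>i\<in>F. t i) powr p"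
    using assms(1,2) insert by (intro powr_add_le_add_powr sum_nonneg) auto
  then show ?case using insert by fastforce
qed auto

lemma norm_add_powr_le:
  fixes x y :: "'a::real_normed_vector"
  assumes "0 < p" "p \<le> 1"
  shows "norm (x + y) powr p \<le> norm x powr p + norm y powr p"
  using powr_add_le_add_powr[OF assms, of "norm x" "norm y"] assms(1)
  by (smt (verit) norm_ge_zero norm_triangle_ineq powr_mono2)

lemma norm_diff_powr_le:
  fixes x y :: "'a::real_normed_vector"
  assumes "0 < p" "p \<le> 1"
  shows "norm (x - y) powr p \<le> norm x powr p + norm y powr p"
  using norm_add_powr_le[OF assms, of x "- y"] by simp

text \<open>Valued in \<open>ennreal\<close> and written as an integral over counting measure, so
  that Tonelli applies without summability conditions. The index set is general: it serves for
  coefficients, for lattice translates at a point and for families indexed by stages.\<close>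

definition lp_mass :: "real \<Rightarrow> 'i set \<Rightarrow> ('i \<Rightarrow> complex) \<Rightarrow> ennreal" where
  "lp_mass p A t = (\<integral>\<^sup>+i. ennreal (norm (t i) powr p) \<partial>count_space A)"

definition Lp_mass :: "real \<Rightarrow> (real ^ 'd \<Rightarrow> complex) \<Rightarrow> ennreal" where
  "Lp_mass p f = (\<integral>\<^sup>+x. ennreal (norm (f x) powr p) \<partial>lebesgue)"

lemma sum_le_nn_integral_count_space:
  fixes g :: "'i \<Rightarrow> ennreal"
  assumes "finite F" "F \<subseteq> A"
  shows "sum g F \<le> (\<integral>\<^sup>+i. g i \<partial>count_space A)"
proof -
  have "sum g F = (\<integral>\<^sup>+i. g i * indicator F i \<partial>count_space A)"
    using assms by (subst nn_integral_count_space'[of F]) (auto simp: indicator_def)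
  also have "\<dots> \<le> (\<integral>\<^sup>+i. g i \<partial>count_space A)"
    by (intro nn_integral_mono) (auto simp: indicator_def)
  finally show ?thesis .
qed

text \<open>The inclusion of l^p in l^1 for \<open>p \<le> 1\<close>, as a bound uniform over finite
  partial sums.\<close>

lemma sum_norm_le_lp_mass:
  assumes "0 < p" "p \<le> 1" "finite F" "F \<subseteq> A" "lp_mass p A t \<le> ennreal B" "0 \<le> B"
  shows "(\<Sum>i\<in>F. norm (t i)) \<le> B powr (1 / p)"
proof -
  have "ennreal (\<Sum>i\<in>F. norm (t i) powr p) = (\<Sum>i\<in>F. ennreal (norm (t i) powr p))"
    by simp
  also have "\<dots> \<le> ennreal B"
    using order_trans[OF sum_le_nn_integral_count_space[OF assms(3,4)] assms(5)[unfolded lp_mass_def]] .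
  finally have "(\<Sum>i\<in>F. norm (t i) powr p) \<le> B" using assms by simp
  moreover have "(\<Sum>i\<in>F. norm (t i)) powr p \<le> (\<Sum>i\<in>F. norm (t i) powr p)"
    using assms by (intro sum_powr_le) auto
  ultimately have "((\<Sum>i\<in>F. norm (t i)) powr p) powr (1/p) \<le> B powr (1/p)"
    using assms by (intro powr_mono2) auto
  then show ?thesis using assms by (simp add: powr_powr sum_nonneg)
qed

lemma lp_mass_imp_abs_summable:
  assumes "0 < p" "p \<le> 1" "lp_mass p A t < \<infinity>"
  shows "(\<lambda>i. norm (t i)) summable_on A"
proof -
  obtain B where B: "0 \<le> B" "lp_mass p A t = ennreal B"
    using assms(3) by (cases "lp_mass p A t") auto
  show ?thesis
  proof (rule nonneg_bdd_above_summable_on)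
    show "bdd_above (sum (\<lambda>i. norm (t i)) ` {F. F \<subseteq> A \<and> finite F})"
      using sum_norm_le_lp_mass[OF assms(1,2), of _ A t B] B
      by (auto intro!: bdd_aboveI[of _ "B powr (1/p)"])
  qed auto
qed

text \<open>An infinite mass makes the bound trivial, whatever default value \<open>infsum\<close>
  takes. Hence it can be applied at every point x, not just almost everywhere.\<close>

lemma norm_infsum_powr_le:
  assumes "0 < p" "p \<le> 1"
  shows "ennreal (norm (infsum t A) powr p) \<le> lp_mass p A t"
proof (cases "lp_mass p A t < \<infinity>")
  case True
  then obtain B where B: "0 \<le> B" "lp_mass p A t = ennreal B"
    by (cases "lp_mass p A t") auto
  have "norm (infsum t A) \<le> (\<Sum>\<^sub>\<infinity>i\<in>A. norm (t i))"
    by (intro norm_infsum_bound lp_mass_imp_abs_summable[OF assms True])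
  also have "\<dots> \<le> B powr (1/p)"
    using sum_norm_le_lp_mass[OF assms, of _ A t B] B
    by (intro infsum_le_finite_sums lp_mass_imp_abs_summable[OF assms True]) auto
  finally have "norm (infsum t A) powr p \<le> (B powr (1/p)) powr p"
    using assms by (intro powr_mono2) auto
  then show ?thesis using B assms by (simp add: powr_powr)
qed (simp add: not_less top_unique)

lemma lp_mass_cmult: "lp_mass p A (\<lambda>i. v * t i) = ennreal (norm v powr p) * lp_mass p A t"
  by (simp add: lp_mass_def norm_mult powr_mult ennreal_mult nn_integral_cmult)

lemma lp_mass_finite_sum:
  assumes "finite F" "F \<subseteq> A" "\<And>i. i \<in> A \<Longrightarrow> i \<notin> F \<Longrightarrow> t i = 0"
  shows "lp_mass p A t = (\<Sum>i\<in>F. ennreal (norm (t i) powr p))"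
  unfolding lp_mass_def using assms by (intro nn_integral_count_space') auto

lemma lp_mass_add:
  assumes "0 < p" "p \<le> 1"
  shows "lp_mass p A (\<lambda>i. s i + t i) \<le> lp_mass p A s + lp_mass p A t"
proof -
  have "lp_mass p A (\<lambda>i. s i + t i) \<le> (\<integral>\<^sup>+i. ennreal (norm (s i) powr p) + ennreal (norm (t i) powr p) \<partial>count_space A)"
    unfolding lp_mass_def
    using norm_add_powr_le[OF assms, of "s _" "t _"]
    by (intro nn_integral_mono) (simp flip: ennreal_plus add: ennreal_leI)
  then show ?thesis by (simp add: lp_mass_def nn_integral_add)
qed

lemma lp_space_iff_mass:
  "c \<in> lp_space p \<longleftrightarrow> lp_mass p ({0<..} \<times> UNIV) (case_prod c) < \<infinity>" (is ?A)
  and lp_norm_eq_mass: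
  "c \<in> lp_space p \<Longrightarrow> lp_norm p c = enn2real (lp_mass p ({0<..} \<times> UNIV) (case_prod c)) powr (1 / p)"
proof -
  let ?g = "\<lambda>i. norm (case_prod c i) powr p"
  have *: "(\<lambda>(j, k). norm (c j k) powr p) = ?g" by auto
  have "c \<in> lp_space p \<longleftrightarrow> ?g summable_on ({0<..} \<times> UNIV)"
    unfolding lp_space_def mem_Collect_eq * ..
  \<comment> \<open>\<open>Infinite_Set_Sum.abs_summable_on\<close> is Bochner integrability for
    counting measure, the bridge from \<open>summable_on\<close> to nonnegative integrals.\<close>
  also have "\<dots> \<longleftrightarrow> Infinite_Set_Sum.abs_summable_on ?g ({0<..} \<times> UNIV)"
    by (subst summable_on_iff_abs_summable_on_real) (rule abs_summable_equivalent)
  finally have iff: "c \<in> lp_space p \<longleftrightarrow> Infinite_Set_Sum.abs_summable_on ?g ({0<..} \<times> UNIV)" .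
  then show ?A
    unfolding lp_mass_def abs_summable_on_def integrable_iff_bounded by simp
  assume "c \<in> lp_space p"
  then have s: "Infinite_Set_Sum.abs_summable_on ?g ({0<..} \<times> UNIV)"
    unfolding iff .
  have "lp_mass p ({0<..} \<times> UNIV) (case_prod c) = ennreal (infsetsum ?g ({0<..} \<times> UNIV))"
    unfolding lp_mass_def using s by (intro nn_integral_conv_infsetsum) auto
  then show "lp_norm p c = enn2real (lp_mass p ({0<..} \<times> UNIV) (case_prod c)) powr (1 / p)"
    using s unfolding lp_norm_def *
    by (simp add: infsetsum_infsum infsum_nonneg)
qed

lemma Lp_mass_add:
  assumes "0 < p" "p \<le> 1" "f \<in> borel_measurable lebesgue" "g \<in> borel_measurable lebesgue"
  shows "Lp_mass p (\<lambda>x. f x + g x) \<le> Lp_mass p f + Lp_mass p g"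
proof -
  note [measurable] = assms(3,4)
  have "Lp_mass p (\<lambda>x. f x + g x) \<le> (\<integral>\<^sup>+x. ennreal (norm (f x) powr p) + ennreal (norm (g x) powr p) \<partial>lebesgue)"
    unfolding Lp_mass_def
    using norm_add_powr_le[OF assms(1,2), of "f _" "g _"]
    by (intro nn_integral_mono) (simp flip: ennreal_plus add: ennreal_leI)
  then show ?thesis by (simp add: Lp_mass_def nn_integral_add)
qed

lemma Lp_mass_cong_AE:
  assumes "AE x in lebesgue. f x = g x"
  shows "Lp_mass p f = Lp_mass p g"
  unfolding Lp_mass_def by (intro nn_integral_cong_AE) (use assms in \<open>auto elim: eventually_mono\<close>)

lemma Lp_mass_cmult:
  assumes "f \<in> borel_measurable lebesgue"
  shows "Lp_mass p (\<lambda>x. v * f x) = ennreal (norm v powr p) * Lp_mass p f"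
  using assms by (simp add: Lp_mass_def norm_mult powr_mult ennreal_mult nn_integral_cmult)

text \<open>Stated for the completed measure, because \<psi> and f are only Lebesgue measurable;
  composition with a merely Borel measurable map need not preserve this.\<close>

lemma distr_lebesgue_minus:
  fixes t :: "'a::euclidean_space"
  shows measurable_minus_lebesgue: "(\<lambda>x. x - t) \<in> lebesgue \<rightarrow>\<^sub>M lebesgue"
    and "distr lebesgue lebesgue (\<lambda>x. x - t) = lebesgue"
proof -
  have eq: "(\<lambda>x. x - t) -` S = (+) t ` S" for S by (force simp: image_iff)
  show m: "(\<lambda>x. x - t) \<in> lebesgue \<rightarrow>\<^sub>M lebesgue"
    by (intro measurableI) (auto simp: eq lebesgue_sets_translation)
  show "distr lebesgue lebesgue (\<lambda>x. x - t) = lebesgue"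
  proof (intro measure_eqI)
    fix A assume A: "A \<in> sets (distr lebesgue lebesgue (\<lambda>x. x - t))"
    have *: "emeasure lebesgue ((+) t ` A) = emeasure lebesgue A" 
      using emeasure_lebesgue_affine[of 1 t A] by (simp add: add.commute cong: image_cong_simp)
    show "emeasure (distr lebesgue lebesgue (\<lambda>x. x - t)) A = emeasure lebesgue A"
      using A m * by (simp add: emeasure_distr eq)
  qed auto
qed

lemma nn_integral_minus_lebesgue:
  fixes g :: "'a::euclidean_space \<Rightarrow> ennreal"
  assumes "g \<in> borel_measurable lebesgue"
  shows "(\<integral>\<^sup>+x. g (x - t) \<partial>lebesgue) = (\<integral>\<^sup>+x. g x \<partial>lebesgue)"
proof -
  have "(\<integral>\<^sup>+x. g x \<partial>lebesgue) = (\<integral>\<^sup>+x. g x \<partial>distr lebesgue lebesgue (\<lambda>x. x - t))"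
    by (simp only: distr_lebesgue_minus(2))
  also have "\<dots> = (\<integral>\<^sup>+x. g (x - t) \<partial>lebesgue)"
    using assms by (intro nn_integral_distr measurable_minus_lebesgue) simp
  finally show ?thesis ..
qed

section \<open>Linear changes of variables\<close>

lemma det_shear_matrix:
  fixes m n :: "'n::finite"
  assumes "m \<noteq> n"
  shows "det (\<chi> i j. of_bool (i = m \<and> j = n \<or> i = j) :: real ^ 'n ^ 'n) = 1"
proof -
  have "(\<chi> i j. of_bool (i = m \<and> j = n \<or> i = j) :: real ^ 'n ^ 'n) =
      (\<chi> k. if k = m then row m (mat 1) + 1 *s row n (mat 1) else row k (mat 1))"
    using assms by (auto simp: vec_eq_iff row_def mat_def)
  then show ?thesis using det_row_operation[OF assms, of "mat 1 :: real ^ 'n ^ 'n" 1] by simp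
qed

lemma content_shear_image:
  fixes m n :: "'n::finite"
  assumes "m \<noteq> n"
  defines "h \<equiv> \<lambda>v::real ^ 'n. \<chi> i. if i = m then v $ m + v $ n else v $ i"
  shows "measure lebesgue (h ` cbox a b) = measure lebesgue (cbox a b)"
proof (cases "cbox a b = {}")
  case False
  \<comment> \<open>The shear formula for boxes wants a nonnegative lower end in direction
    \<open>n\<close>; translating by \<open>t\<close> makes that end 0.\<close>
  define t :: "real ^ 'n" where "t = (\<chi> i. if i = n then a $ n else 0)"
  have lin: "linear h"
    by (rule linearI) (auto simp: h_def algebra_simps plus_vec_def scaleR_vec_def vec_eq_iff)
  have box: "cbox a b = (+) t ` cbox (a - t) (b - t)"
    using cbox_translation[of t "a - t" "b - t"] by simp
  have "h ` cbox a b = (+) (h t) ` h ` cbox (a - t) (b - t)"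
    unfolding box image_comp by (auto simp: linear_add[OF lin])
  then have "measure lebesgue (h ` cbox a b) = measure lebesgue (h ` cbox (a - t) (b - t))"
    by (simp only: measure_translation)
  also have "\<dots> = measure lebesgue (cbox (a - t) (b - t))"
    unfolding h_def using False box assms(1) by (intro measure_shear_interval) (auto simp: t_def)
  also have "\<dots> = measure lebesgue (cbox a b)"
    unfolding box by (simp only: measure_translation)
  finally show ?thesis .
qed auto

lemma content_transposition_image:
  fixes m n :: "'n::finite"
  defines "h \<equiv> \<lambda>v::real ^ 'n. \<chi> i. v $ Transposition.transpose m n i"
  shows "measure lebesgue (h ` cbox a b) = measure lebesgue (cbox a b)"
proof (cases "cbox a b = {}")
  case False
  \<comment> \<open>An involution that sends boxes into boxes: the image of a box is exactly the box
    with permuted corners.\<close>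
  have "h (h v) = v" for v by (simp add: h_def)
  moreover have "h v \<in> cbox (h a) (h b)" if "v \<in> cbox a b" for a b v
    using that by (simp add: h_def mem_box_cart)
  ultimately have eq: "h ` cbox a b = cbox (h a) (h b)"
    by (auto simp: image_iff) (metis)
  then have ne: "cbox (h a) (h b) \<noteq> {}" using False by auto
  have "(\<Prod>i\<in>UNIV. (b - a) $ Transposition.transpose m n i) = (\<Prod>i\<in>UNIV. (b - a) $ i)"
    using prod.permute[OF permutes_swap_id, of m UNIV n "\<lambda>i. (b - a) $ i"] by (simp add: o_def)
  then show ?thesis
    unfolding eq using ne False by (simp add: content_cbox_cart h_def)
qed auto

text \<open>The library proves this only for well-ordered index types.\<close>

lemma measure_matrix_image:
  fixes A :: "real ^ 'n ^ 'n"
  assumes "S \<in> lmeasurable"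
  shows "(*v) A ` S \<in> lmeasurable"
    and "measure lebesgue ((*v) A ` S) = \<bar>det A\<bar> * measure lebesgue S"
proof -
  have "\<forall>S\<in>lmeasurable. (*v) A ` S \<in> lmeasurable \<and>
      measure lebesgue ((*v) A ` S) = \<bar>det A\<bar> * measure lebesgue S"
  \<comment> \<open>The claim is multiplicative in \<open>A\<close>, which leaves matrices with a
    zero row, diagonal matrices, transpositions and elementary shears.\<close>
  proof (induction A rule: induct_matrix_elementary_alt)
    case (1 A B)
    moreover have "(*v) (A ** B) ` S = (*v) A ` (*v) B ` S" for S
      by (simp only: image_comp matrix_vector_mult_matrix_matrix_mult_compose)
    ultimately show ?case by (simp add: det_mul abs_mult)
  next
    case (2 A i)
    then have d: "det A = 0" by (rule det_zero_row(2))
    then have "\<not> inj ((*v) A)" using det_nz_iff_inj[of "(*v) A"] by (simp add: matrix_of_matrix_vector_mul)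
    then have "negligible ((*v) A ` S)" for S
      by (intro negligible_linear_singular_image) auto
    then show ?case by (simp add: d negligible_iff_measure)
  next
    case (3 A)
    have "(*v) A = (\<lambda>x. \<chi> k. A $ k $ k * x $ k)"
    proof
      fix x
      have "(\<Sum>j\<in>UNIV. A $ i $ j * x $ j) = A $ i $ i * x $ i" for i
        by (subst sum.remove[of _ i]) (use 3 in auto)
      then show "A *v x = (\<chi> k. A $ k $ k * x $ k)"
        by (simp add: matrix_vector_mult_def)
    qed
    then show ?case
      using measurable_stretch[of _ "\<lambda>k. A $ k $ k"] measure_stretch[of _ "\<lambda>k. A $ k $ k"]
      by (simp add: det_diagonal[OF 3])
  next
    case (4 m n)
    let ?A = "\<chi> i j. mat 1 $ i $ Transposition.transpose m n j :: real ^ 'n ^ 'n"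
    have eq: "?A *v v = (\<chi> i. v $ Transposition.transpose m n i)" for v
    proof -
      have "(\<Sum>j\<in>UNIV. mat 1 $ i $ Transposition.transpose m n j * v $ j) = v $ Transposition.transpose m n i" for i
        by (subst sum.remove[of _ "Transposition.transpose m n i"])
          (auto simp: mat_def intro!: sum.neutral split: if_splits)
      then show ?thesis by (simp add: matrix_vector_mult_def)
    qed
    have A: "(*v) ?A = (\<lambda>v. \<chi> i. v $ Transposition.transpose m n i)" using eq by (rule ext)
    have "\<bar>det ?A\<bar> = 1"
      by (subst det_permute_columns) (auto simp: permutes_swap_id sign_swap_id abs_mult 4)
    then have d: "\<bar>det ?A\<bar> * x = 1 * x" for x by (simp only:)
    have "(*v) ?A ` S \<in> lmeasurable \<and> 1 * measure lebesgue S = measure lebesgue ((*v) ?A ` S)"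
      if "S \<in> lmeasurable" for S
    \<comment> \<open>For a linear map the scaling factor on boxes determines it on all sets of
      finite measure.\<close>
    proof (rule measure_linear_sufficient[OF matrix_vector_mul_linear that])
      show "measure lebesgue ((*v) ?A ` cbox a b) = 1 * measure lebesgue (cbox a b)" for a b
        unfolding A by (simp only: content_transposition_image mult_1)
    qed
    then show ?case unfolding d by metis
  next
    case (5 m n)
    let ?A = "\<chi> i j. of_bool (i = m \<and> j = n \<or> i = j) :: real ^ 'n ^ 'n"
    have eq: "?A *v v = (\<chi> i. if i = m then v $ m + v $ n else v $ i)" for v
    proof -
      have "of_bool (i = m \<and> j = n \<or> i = j) * v $ j =
          (if j = i then v $ j else 0) + (if j = n then (if i = m then v $ n else 0) else 0)" for i j
        using 5 by auto
      then have "(\<Sum>j\<in>UNIV. of_bool (i = m \<and> j = n \<or> i = j) * v $ j) = (if i = m then v $ m + v $ n else v $ i)" for i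
        by (simp add: sum.distrib)
      then show ?thesis by (simp add: matrix_vector_mult_def)
    qed
    then have A: "(*v) ?A = (\<lambda>v. \<chi> i. if i = m then v $ m + v $ n else v $ i)" by (rule ext)
    have "(*v) ?A ` S \<in> lmeasurable \<and> 1 * measure lebesgue S = measure lebesgue ((*v) ?A ` S)"
      if "S \<in> lmeasurable" for S
    proof (rule measure_linear_sufficient[OF matrix_vector_mul_linear that])
      show "measure lebesgue ((*v) ?A ` cbox a b) = 1 * measure lebesgue (cbox a b)" for a b
        unfolding A by (simp only: content_shear_image[OF 5] mult_1)
    qed
    note * = this
    show ?case
    proof (intro ballI conjI)
      fix S :: "(real ^ 'n) set"
      assume S: "S \<in> lmeasurable"
      show "(*v) ?A ` S \<in> lmeasurable" by (rule conjunct1[OF *[OF S]])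
      show "measure lebesgue ((*v) ?A ` S) = \<bar>det ?A\<bar> * measure lebesgue S"
        unfolding det_shear_matrix[OF 5] abs_one by (rule conjunct2[OF *[OF S], symmetric])
    qed
  qed
  then show "(*v) A ` S \<in> lmeasurable" "measure lebesgue ((*v) A ` S) = \<bar>det A\<bar> * measure lebesgue S"
    using assms by auto
qed

lemma matrix_inv_mult:
  fixes T :: "real ^ 'd ^ 'd"
  assumes "invertible T"
  shows "T ** matrix_inv T = mat 1" "matrix_inv T ** T = mat 1"
  using assms someI_ex[of "\<lambda>A'. T ** A' = mat 1 \<and> A' ** T = mat 1"]
  by (auto simp: invertible_def matrix_inv_def)

lemma matrix_inv_vector_mult:
  fixes T :: "real ^ 'd ^ 'd"
  assumes "invertible T"
  shows "T *v (matrix_inv T *v x) = x" "matrix_inv T *v (T *v x) = x"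
  using matrix_inv_mult[OF assms] by (simp_all add: matrix_vector_mul_assoc)

lemma matrix_vimage_lebesgue:
  fixes T :: "real ^ 'd ^ 'd"
  assumes T: "invertible T" and S: "S \<in> sets lebesgue"
  shows "(*v) T -` S \<in> sets lebesgue"
    and "emeasure lebesgue ((*v) T -` S) = ennreal (1 / \<bar>det T\<bar>) * emeasure lebesgue S"
proof -
  note TT = matrix_inv_vector_mult[OF T]
  have eq: "(*v) T -` S = (*v) (matrix_inv T) ` S" for S
    using TT by (auto simp: image_iff) metis
  have eq': "(*v) T ` ((*v) T -` S) = S" for S
    using TT by (auto simp: image_iff) metis
  have meas: "(*v) A ` S \<in> sets lebesgue" if "S \<in> sets lebesgue" for S and A :: "real ^ 'd ^ 'd"
    using that by (intro differentiable_image_in_sets_lebesgue linear_imp_differentiable_on) auto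
  show ms: "(*v) T -` S \<in> sets lebesgue" unfolding eq using S by (rule meas)
  have dT: "det T \<noteq> 0" using T by (simp add: invertible_det_nz)
  show "emeasure lebesgue ((*v) T -` S) = ennreal (1 / \<bar>det T\<bar>) * emeasure lebesgue S"
  proof (cases "(*v) T -` S \<in> lmeasurable")
    case True
    then have "S \<in> lmeasurable" using measure_matrix_image(1)[OF True, of T] eq' by simp
    moreover have "measure lebesgue S = \<bar>det T\<bar> * measure lebesgue ((*v) T -` S)"
      using measure_matrix_image(2)[OF True, of T] eq' by simp
    ultimately show ?thesis using True dT
      by (simp add: emeasure_eq_measure2 flip: ennreal_mult')
  next
    case False
    \<comment> \<open>Preimages under \<open>T\<close> are images under its inverse, so finiteness
      of the measure passes both ways and here both sides are infinite.\<close>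
    then have "S \<notin> lmeasurable" using measure_matrix_image(1) eq by metis
    then have "emeasure lebesgue S = \<infinity>" "emeasure lebesgue ((*v) T -` S) = \<infinity>"
      using False S ms unfolding fmeasurable_def by (auto simp: not_less top_unique)
    then show ?thesis using dT
      by (simp only:) (simp add: ennreal_mult_top)
  qed
qed

lemma measurable_matrix_vector_mult_lebesgue:
  fixes T :: "real ^ 'd ^ 'd"
  assumes "invertible T"
  shows "(*v) T \<in> lebesgue \<rightarrow>\<^sub>M lebesgue"
  using matrix_vimage_lebesgue(1)[OF assms] by (intro measurableI) auto

lemma nn_integral_matrix_vector_mult:
  fixes T :: "real ^ 'd ^ 'd" and g :: "real ^ 'd \<Rightarrow> ennreal"
  assumes T: "invertible T" and g: "g \<in> borel_measurable lebesgue"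
  shows "(\<integral>\<^sup>+x. g (T *v x) \<partial>lebesgue) = ennreal (1 / \<bar>det T\<bar>) * (\<integral>\<^sup>+x. g x \<partial>lebesgue)"
proof -
  note [measurable] = g measurable_matrix_vector_mult_lebesgue[OF T]
  have "distr lebesgue lebesgue ((*v) T) = scale_measure (ennreal (1 / \<bar>det T\<bar>)) lebesgue"
    using matrix_vimage_lebesgue[OF T] by (intro measure_eqI) (auto simp: emeasure_distr)
  then have "(\<integral>\<^sup>+x. g x \<partial>distr lebesgue lebesgue ((*v) T)) = ennreal (1 / \<bar>det T\<bar>) * (\<integral>\<^sup>+x. g x \<partial>lebesgue)"
    by (simp add: nn_integral_scale_measure)
  then show ?thesis by (simp add: nn_integral_distr)
qed

section \<open>Sums over the integer lattice\<close>

text \<open>Completeness of Lebesgue measure: the preimages under f and g differ by part of a null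
  set, all of whose subsets are measurable.\<close>

lemma borel_measurable_lebesgue_cong_AE:
  fixes f g :: "'a::euclidean_space \<Rightarrow> 'b::topological_space"
  assumes "AE x in lebesgue. f x = g x" "g \<in> borel_measurable lebesgue"
  shows "f \<in> borel_measurable lebesgue"
proof (rule measurableI)
  fix A :: "'b set" assume A: "A \<in> sets borel"
  define N where "N = {x. f x \<noteq> g x}"
  have N: "N \<in> null_sets lebesgue"
    using assms(1) by (auto simp: N_def completion.AE_iff_null_sets)
  have "f -` A \<inter> space lebesgue = (g -` A \<inter> space lebesgue - N) \<union> (f -` A \<inter> N)"
    by (auto simp: N_def)
  also have "\<dots> \<in> sets lebesgue"
    using N measurable_sets[OF assms(2) A] null_sets_completion_subset[of "f -` A \<inter> N" N lborel]
    by (intro sets.Un sets.Diff) auto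
  finally show "f -` A \<inter> space lebesgue \<in> sets lebesgue" .
qed auto

text \<open>Encodes the tiling by translates of \<open>unit_cube\<close>: x lies in the cell
  \<open>k\<close> iff \<open>lattice_floor x = k\<close>, so that disjointness and covering come
  for free.\<close>

definition lattice_floor :: "real ^ 'd \<Rightarrow> int ^ 'd" where
  "lattice_floor x = (\<chi> i. \<lfloor>x $ i\<rfloor>)"

lemma lattice_point_0 [simp]: "lattice_point 0 = 0"
  by (simp add: lattice_point_def vec_eq_iff)

lemma lattice_point_add: "lattice_point (k + l) = lattice_point k + lattice_point l"
  by (simp add: lattice_point_def vec_eq_iff)

lemma lattice_floor_diff: "lattice_floor (x - lattice_point k) = lattice_floor x - k"
  by (simp add: lattice_point_def lattice_floor_def vec_eq_iff)

lemma unit_cube_eq: "x \<in> unit_cube \<longleftrightarrow> lattice_floor x = 0"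
  by (auto simp: unit_cube_def lattice_floor_def vec_eq_iff floor_eq_iff)

text \<open>The l^1 norm gives a crude bound; only its independence of x matters.\<close>

lemma norm_minus_lattice_floor:
  fixes x :: "real ^ 'd"
  shows "norm (x - lattice_point (lattice_floor x)) \<le> real CARD('d)"
proof -
  have "\<bar>(x - lattice_point (lattice_floor x)) $ i\<bar> \<le> 1" for i
    by (simp add: lattice_point_def lattice_floor_def) linarith
  then have "(\<Sum>i\<in>UNIV. \<bar>(x - lattice_point (lattice_floor x)) $ i\<bar>) \<le> (\<Sum>i\<in>(UNIV::'d set). 1)"
    by (intro sum_mono)
  then show ?thesis using norm_le_l1_cart[of "x - lattice_point (lattice_floor x)"] by simp
qed

lemma finite_lattice_points_cball:
  fixes x :: "real ^ 'd"
  shows "finite {k. norm (x - lattice_point k) \<le> R}"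
proof -
  define a where "a = (\<lambda>i. \<lfloor>x $ i - R\<rfloor>)"
  define b where "b = (\<lambda>i. \<lceil>x $ i + R\<rceil>)"
  have "{k. norm (x - lattice_point k) \<le> R} \<subseteq> vec_lambda ` (\<Pi>\<^sub>E i\<in>UNIV. {a i..b i})"
  proof
    fix k assume "k \<in> {k. norm (x - lattice_point k) \<le> R}"
    then have "\<bar>x $ i - of_int (k $ i)\<bar> \<le> R" for i
      using component_le_norm_cart[of "x - lattice_point k" i] by (auto simp: lattice_point_def)
    then have "k $ i \<in> {a i..b i}" for i
      unfolding a_def b_def by (simp add: floor_le_iff le_ceiling_iff abs_le_iff) (smt (verit))
    then have "vec_nth k \<in> (\<Pi>\<^sub>E i\<in>UNIV. {a i..b i})" by auto
    then show "k \<in> vec_lambda ` (\<Pi>\<^sub>E i\<in>UNIV. {a i..b i})"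
      by (intro image_eqI[of _ _ "vec_nth k"]) auto
  qed
  then show ?thesis by (rule finite_subset) (intro finite_imageI finite_PiE; simp)
qed

text \<open>The half-open cell is squeezed between an open and a closed box of volume 1.\<close>

lemma lattice_floor_vimage:
  fixes k :: "int ^ 'd"
  shows "{x. lattice_floor x = k} \<in> sets lebesgue" "emeasure lebesgue {x. lattice_floor x = k} = 1"
proof -
  have mem: "lattice_floor x = k \<longleftrightarrow> (\<forall>i. real_of_int (k $ i) \<le> x $ i \<and> x $ i < real_of_int (k $ i) + 1)" for x :: "real ^ 'd"
    by (auto simp: lattice_floor_def vec_eq_iff floor_eq_iff)
  let ?l = "lattice_point k"
  let ?u = "\<chi> i. real_of_int (k $ i) + 1"
  have eq: "{x. lattice_floor x = k} = (\<Inter>i. {x. ?l $ i \<le> x $ i} \<inter> {x. x $ i < ?u $ i})"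
    by (auto simp: mem lattice_point_def)
  have "{x. lattice_floor x = k} \<in> sets borel" unfolding eq
    by (intro sets.finite_INT sets.Int) (auto intro!: borel_closed borel_open
      closed_halfspace_component_ge_cart open_halfspace_component_lt_cart)
  then show s: "{x. lattice_floor x = k} \<in> sets lebesgue" by simp
  have one: "(?u - ?l) \<bullet> b = 1" "?l \<bullet> b \<le> ?u \<bullet> b" if "b \<in> Basis" for b :: "real ^ 'd"
    using that by (auto simp: Basis_vec_def lattice_point_def inner_axis)
  have "(\<Prod>b\<in>Basis. (?u - ?l) \<bullet> b) = 1" by (rule prod.neutral) (use one in auto)
  then have c: "emeasure lebesgue (box ?l ?u) = 1" "emeasure lebesgue (cbox ?l ?u) = 1"
    using emeasure_lborel_box[of ?l ?u] emeasure_lborel_cbox[of ?l ?u] one(2) by simp_all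
  have "emeasure lebesgue (box ?l ?u) \<le> emeasure lebesgue {x. lattice_floor x = k}"
    using s by (intro emeasure_mono) (auto simp: mem mem_box_cart lattice_point_def less_imp_le)
  moreover have "emeasure lebesgue {x. lattice_floor x = k} \<le> emeasure lebesgue (cbox ?l ?u)"
    by (intro emeasure_mono) (auto simp: mem mem_box_cart lattice_point_def less_imp_le)
  ultimately show "emeasure lebesgue {x. lattice_floor x = k} = 1" using c by simp
qed

lemma measurable_lattice_floor [measurable]: "lattice_floor \<in> lebesgue \<rightarrow>\<^sub>M count_space UNIV"
  using lattice_floor_vimage(1)
  by (subst measurable_count_space_eq_countable) (auto simp: vimage_def)

lemma emeasure_lattice_floor_vimage:
  assumes "finite I"
  shows "emeasure lebesgue {x. lattice_floor x \<in> I} = of_nat (card I)"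
proof -
  have "{x. lattice_floor x \<in> I} = (\<Union>k\<in>I. {x. lattice_floor x = k})" by auto
  also have "emeasure lebesgue \<dots> = (\<Sum>k\<in>I. emeasure lebesgue {x. lattice_floor x = k})"
    by (intro sum_emeasure[symmetric]) (auto simp: assms disjoint_family_on_def lattice_floor_vimage(1))
  finally show ?thesis by (simp add: lattice_floor_vimage(2))
qed

text \<open>The periodization in lattice coordinates and without determinant: for \<phi> equal to
  \<psi> composed with \<open>b\<close>, |det b| times it is P\<psi>(b x).\<close>

definition lattice_sum :: "(real ^ 'd \<Rightarrow> complex) \<Rightarrow> real ^ 'd \<Rightarrow> complex" where
  "lattice_sum \<phi> x = (\<Sum>\<^sub>\<infinity>k\<in>UNIV. \<phi> (x - lattice_point k))"

lemma lattice_sum_periodic: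
  fixes x :: "real ^ 'd"
  shows "lattice_sum \<phi> (x - lattice_point m) = lattice_sum \<phi> x"
proof -
  have "bij (\<lambda>k::int ^ 'd. m + k)" by (rule bij_betw_byWitness[where f' = "\<lambda>k. k - m"]) auto
  from infsum_reindex_bij_betw[OF this, of "\<lambda>k. \<phi> (x - lattice_point k)"]
  show ?thesis by (simp add: lattice_sum_def lattice_point_add algebra_simps)
qed

lemma AE_minus_lebesgue:
  fixes t :: "'a::euclidean_space"
  assumes "AE x in lebesgue. P x"
  shows "AE x in lebesgue. P (x - t)"
proof -
  have "AE x in distr lebesgue lebesgue (\<lambda>x. x - t). P x"
    using assms by (simp only: distr_lebesgue_minus(2))
  then show ?thesis
    using AE_distrD[OF measurable_minus_lebesgue, of P t] by simp
qed

lemma measurable_translate_lebesgue: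
  fixes \<phi> :: "'a::euclidean_space \<Rightarrow> 'b"
  assumes "\<phi> \<in> lebesgue \<rightarrow>\<^sub>M N"
  shows "(\<lambda>x. \<phi> (x - t)) \<in> lebesgue \<rightarrow>\<^sub>M N"
  using measurable_compose[OF measurable_minus_lebesgue assms] .

text \<open>There are countably many translates, so one null set serves all \<open>k\<close> at
  once.\<close>

lemma AE_lattice_translates_support:
  fixes \<phi> :: "real ^ 'd \<Rightarrow> complex"
  assumes "AE x in lebesgue. R < norm x \<longrightarrow> \<phi> x = 0"
  shows "AE x in lebesgue. \<forall>k. R < norm (x - lattice_point k) \<longrightarrow> \<phi> (x - lattice_point k) = 0"
  using AE_minus_lebesgue[OF assms] by (simp add: AE_all_countable)

text \<open>Its integral is the p-th power of the quasi-norm in the hypothesis of the theorem, with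
  \<mu> = \<lambda> |det b|. Kept as a function of x so that it can be translated to any
  cell.\<close>

definition cube_deviation :: "real \<Rightarrow> complex \<Rightarrow> (real ^ 'd \<Rightarrow> complex) \<Rightarrow> real ^ 'd \<Rightarrow> ennreal" where
  "cube_deviation p \<mu> \<phi> x = ennreal (norm (1 - \<mu> * lattice_sum \<phi> x) powr p) * indicator unit_cube x"

lemma cube_deviation_AE:
  fixes \<phi> :: "real ^ 'd \<Rightarrow> complex"
  assumes "AE x in lebesgue. R < norm x \<longrightarrow> \<phi> x = 0"
  obtains F where "finite F"
    "AE x in lebesgue. cube_deviation p \<mu> \<phi> x =
       ennreal (norm (1 - \<mu> * (\<Sum>k\<in>F. \<phi> (x - lattice_point k))) powr p) * indicator unit_cube x"
proof
  define F where "F = {k::int ^ 'd. norm (0 - lattice_point k :: real ^ 'd) \<le> R + real CARD('d)}"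
  show "finite F" unfolding F_def by (rule finite_lattice_points_cball)
  show "AE x in lebesgue. cube_deviation p \<mu> \<phi> x =
       ennreal (norm (1 - \<mu> * (\<Sum>k\<in>F. \<phi> (x - lattice_point k))) powr p) * indicator unit_cube x"
    using AE_lattice_translates_support[OF assms]
  proof eventually_elim
    case (elim x)
    have "lattice_sum \<phi> x = (\<Sum>k\<in>F. \<phi> (x - lattice_point k))" if "x \<in> unit_cube"
    proof -
      have x: "norm x \<le> real CARD('d)"
        using norm_minus_lattice_floor[of x] that by (simp add: unit_cube_eq)
      have "\<phi> (x - lattice_point k) = 0" if "k \<notin> F" for k
      proof -
        have "norm (lattice_point k :: real ^ 'd) \<le> norm x + norm (x - lattice_point k)"
          by (metis add.commute diff_diff_eq2 norm_triangle_ineq4 diff_add_cancel add_diff_cancel_left')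
        then show ?thesis using that x elim[rule_format, of k] by (simp add: F_def)
      qed
      then have "lattice_sum \<phi> x = (\<Sum>\<^sub>\<infinity>k\<in>F. \<phi> (x - lattice_point k))"
        unfolding lattice_sum_def by (intro infsum_cong_neutral) auto
      then show ?thesis using \<open>finite F\<close> by simp
    qed
    then show ?case by (auto simp: cube_deviation_def indicator_def)
  qed
qed

lemma measurable_unit_cube: "(unit_cube :: (real ^ 'd) set) \<in> sets lebesgue"
  and emeasure_unit_cube: "emeasure lebesgue (unit_cube :: (real ^ 'd) set) = 1"
proof -
  have *: "unit_cube = {x :: real ^ 'd. lattice_floor x = 0}" by (auto simp: unit_cube_eq)
  show "(unit_cube :: (real ^ 'd) set) \<in> sets lebesgue" unfolding * by (rule lattice_floor_vimage)
  show "emeasure lebesgue (unit_cube :: (real ^ 'd) set) = 1" unfolding * by (rule lattice_floor_vimage)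
qed

lemma measurable_cube_deviation:
  assumes "AE x in lebesgue. R < norm x \<longrightarrow> \<phi> x = 0" "\<phi> \<in> borel_measurable lebesgue"
  shows "cube_deviation p \<mu> \<phi> \<in> borel_measurable lebesgue"
proof -
  note [measurable] = measurable_translate_lebesgue[OF assms(2)] measurable_unit_cube
  obtain F where "finite F"
    "AE x in lebesgue. cube_deviation p \<mu> \<phi> x =
       ennreal (norm (1 - \<mu> * (\<Sum>k\<in>F. \<phi> (x - lattice_point k))) powr p) * indicator unit_cube x"
    using cube_deviation_AE[OF assms(1)] .
  then show ?thesis
    by (intro borel_measurable_lebesgue_cong_AE[OF \<open>AE x in _. _ x = _\<close>]) measurable
qed

text \<open>The hypothesis of the theorem is about a Bochner integral, which is 0 for nonintegrable
  functions; finiteness must be known before the bound < 1 carries over to the nonnegative integral.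
  It holds because the lattice sum on the cube is a finite sum of translates of \<phi>.\<close>

lemma nn_integral_cube_deviation_finite:
  assumes p: "0 < p" "p \<le> 1"
    and "AE x in lebesgue. R < norm x \<longrightarrow> \<phi> x = 0" and [measurable]: "\<phi> \<in> borel_measurable lebesgue"
    and "Lp_mass p \<phi> < \<infinity>"
  shows "(\<integral>\<^sup>+x. cube_deviation p \<mu> \<phi> x \<partial>lebesgue) < \<infinity>"
proof -
  note [measurable] = measurable_translate_lebesgue[OF assms(4)] measurable_unit_cube
  obtain F where F: "finite F"
    "AE x in lebesgue. cube_deviation p \<mu> \<phi> x =
       ennreal (norm (1 - \<mu> * (\<Sum>k\<in>F. \<phi> (x - lattice_point k))) powr p) * indicator unit_cube x"
    using cube_deviation_AE[OF assms(3)] .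
  have *: "norm (1 - \<mu> * (\<Sum>k\<in>F. \<phi> (x - lattice_point k))) powr p
      \<le> 1 + (\<Sum>k\<in>F. norm \<mu> powr p * norm (\<phi> (x - lattice_point k)) powr p)" for x
  proof -
    have "norm (\<mu> * (\<Sum>k\<in>F. \<phi> (x - lattice_point k))) powr p
        \<le> (\<Sum>k\<in>F. norm (\<mu> * \<phi> (x - lattice_point k))) powr p"
      unfolding sum_distrib_left using p by (intro powr_mono2 norm_sum) auto
    also have "\<dots> \<le> (\<Sum>k\<in>F. norm (\<mu> * \<phi> (x - lattice_point k)) powr p)"
      using p by (intro sum_powr_le) auto
    finally show ?thesis
      using norm_diff_powr_le[OF p, of 1 "\<mu> * (\<Sum>k\<in>F. \<phi> (x - lattice_point k))"]
      by (simp add: norm_mult powr_mult)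
  qed
  have "(\<integral>\<^sup>+x. cube_deviation p \<mu> \<phi> x \<partial>lebesgue) \<le>
      (\<integral>\<^sup>+x. indicator unit_cube x + (\<Sum>k\<in>F. ennreal (norm \<mu> powr p) * ennreal (norm (\<phi> (x - lattice_point k)) powr p)) \<partial>lebesgue)"
    using F(2)
    by (intro nn_integral_mono_AE; eventually_elim)
      (use * in \<open>auto simp: indicator_def ennreal_mult[symmetric] ennreal_1[symmetric] ennreal_plus[symmetric] sum_nonneg
        simp del: ennreal_1 ennreal_plus intro!: ennreal_leI\<close>)
  also have "\<dots> = 1 + (\<Sum>k\<in>F. ennreal (norm \<mu> powr p) * Lp_mass p \<phi>)"
    using nn_integral_minus_lebesgue[of "\<lambda>x. ennreal (norm (\<phi> x) powr p)"]
    by (simp add: nn_integral_add nn_integral_sum nn_integral_cmult emeasure_unit_cube Lp_mass_def)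
  also have "\<dots> < \<infinity>"
    using assms(5) by (auto simp: ennreal_mult_less_top of_nat_less_top)
  finally show ?thesis .
qed

section \<open>Boundary error of finite lattice sums\<close>

lemma borel_measurable_nn_integral_count_space:
  fixes f :: "'i \<Rightarrow> 'a \<Rightarrow> ennreal"
  assumes "countable I" "\<And>i. i \<in> I \<Longrightarrow> f i \<in> borel_measurable M"
  shows "(\<lambda>x. \<integral>\<^sup>+i. f i x \<partial>count_space I) \<in> borel_measurable M"
proof (rule sigma_finite_measure.borel_measurable_nn_integral)
  show "sigma_finite_measure (count_space I)"
    using assms(1) by (rule sigma_finite_measure_count_space_countable)
  show "(\<lambda>(x, i). f i x) \<in> borel_measurable (M \<Otimes>\<^sub>M count_space I)"
    using measurable_compose_countable'[of I "\<lambda>i z. f i (fst z)" "M \<Otimes>\<^sub>M count_space I" borel snd]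
      assms by (simp add: split_beta')
qed

text \<open>Only the outer side is recorded; points just inside \<open>I\<close> are reached from it
  by a shift.\<close>

definition lattice_boundary :: "real \<Rightarrow> (int ^ 'd) set \<Rightarrow> (int ^ 'd) set" where
  "lattice_boundary r I = {m. m \<notin> I \<and> (\<exists>k\<in>I. norm (lattice_point m - lattice_point k :: real ^ 'd) \<le> r)}"

lemma finite_lattice_boundary:
  fixes I :: "(int ^ 'd) set"
  assumes "finite I"
  shows "finite (lattice_boundary r I)"
proof -
  have "lattice_boundary r I \<subseteq> (\<Union>k\<in>I. {m. norm (lattice_point k - lattice_point m :: real ^ 'd) \<le> r})"
    by (auto simp: lattice_boundary_def norm_minus_commute)
  moreover have "finite \<dots>"
    using assms finite_lattice_points_cball by (intro finite_UN_I)
  ultimately show ?thesis by (rule finite_subset)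
qed

text \<open>A point of \<open>I\<close> that the shift moves out lands in the outer boundary, and a
  point outside that the shift moves in already lies there; hence the factor 2.\<close>

lemma nn_integral_shift_difference_le:
  fixes I :: "(int ^ 'd) set"
  assumes "finite I" "norm (lattice_point l :: real ^ 'd) \<le> r"
  shows "(\<integral>\<^sup>+k. of_bool ((l + k \<in> I) \<noteq> (k \<in> I)) \<partial>count_space UNIV) \<le> 2 * of_nat (card (lattice_boundary r I))"
proof -
  let ?B = "lattice_boundary r I"
  let ?D = "{k. (l + k \<in> I) \<noteq> (k \<in> I)}"
  have sub: "?D \<subseteq> ?B \<union> (\<lambda>m. m - l) ` ?B"
  proof
    fix k assume k: "k \<in> ?D"
    show "k \<in> ?B \<union> (\<lambda>m. m - l) ` ?B"
    proof (cases "k \<in> I")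
      case True
      then have "l + k \<in> ?B" using k assms(2)
        by (auto simp: lattice_boundary_def lattice_point_add intro!: bexI[of _ k])
      then show ?thesis by (auto intro: image_eqI[of _ _ "l + k"])
    next
      case False
      then have "k \<in> ?B" using k assms(2)
        by (auto simp: lattice_boundary_def lattice_point_add intro!: bexI[of _ "l + k"])
      then show ?thesis by auto
    qed
  qed
  note fin = finite_lattice_boundary[OF assms(1), of r]
  have finD: "finite ?D" using finite_subset[OF sub] fin by auto
  have "card ?D \<le> card (?B \<union> (\<lambda>m. m - l) ` ?B)"
    using fin by (intro card_mono sub) auto
  also have "\<dots> \<le> card ?B + card ?B"
    using card_Un_le[of ?B "(\<lambda>m. m - l) ` ?B"] card_image_le[OF fin, of "\<lambda>m. m - l"] by linarith
  finally have "(of_nat (card ?D) :: ennreal) \<le> of_nat (2 * card ?B)" by (intro of_nat_mono) simp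
  moreover have "(\<integral>\<^sup>+k. of_bool ((l + k \<in> I) \<noteq> (k \<in> I)) \<partial>count_space UNIV) = (of_nat (card ?D) :: ennreal)"
    using finD by (subst nn_integral_count_space'[of ?D]) auto
  ultimately show ?thesis by simp
qed

text \<open>
  On the cells indexed by \<open>I\<close> the full lattice sum would give the deviation from one; replacing it by
  the sum over \<open>I\<close> only costs contributions across the boundary of \<open>I\<close>.
\<close>

lemma Lp_mass_lattice_approx:
  fixes \<phi> :: "real ^ 'd \<Rightarrow> complex"
  assumes p: "0 < p" "p \<le> 1"
    and supp: "AE x in lebesgue. R < norm x \<longrightarrow> \<phi> x = 0"
    and meas [measurable]: "\<phi> \<in> borel_measurable lebesgue"
    and I: "finite I"
  shows "Lp_mass p (\<lambda>x. of_bool (lattice_floor x \<in> I) - \<mu> * (\<Sum>k\<in>I. \<phi> (x - lattice_point k)))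
    \<le> of_nat (card I) * (\<integral>\<^sup>+x. cube_deviation p \<mu> \<phi> x \<partial>lebesgue)
      + ennreal (norm \<mu> powr p) * (2 * of_nat (card (lattice_boundary (R + real CARD('d)) I)) * Lp_mass p \<phi>)"
proof -
  note [measurable] = measurable_translate_lebesgue[OF meas]
    measurable_translate_lebesgue[OF measurable_cube_deviation[OF supp meas]]
  \<comment> \<open>\<open>h k x\<close> is nonzero exactly when the cell of x and \<open>k\<close>
    disagree about membership in \<open>I\<close>. Summed against the translates of \<phi> it gives
    the difference between the full lattice sum on the cells of \<open>I\<close> and the sum over
    \<open>I\<close>; \<open>E x\<close> is the mass of these terms.\<close>
  define h where "h k x = (of_bool (lattice_floor x \<in> I) :: complex) - of_bool (k \<in> I)" for k x
  define E where "E x = (\<integral>\<^sup>+k. of_bool ((lattice_floor x \<in> I) \<noteq> (k \<in> I)) * ennreal (norm (\<phi> (x - lattice_point k)) powr p) \<partial>count_space UNIV)" for x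
  have E [measurable]: "E \<in> borel_measurable lebesgue"
    unfolding E_def by (intro borel_measurable_nn_integral_count_space) auto
  have "AE x in lebesgue. ennreal (norm (of_bool (lattice_floor x \<in> I) - \<mu> * (\<Sum>k\<in>I. \<phi> (x - lattice_point k))) powr p)
      \<le> (\<Sum>m\<in>I. cube_deviation p \<mu> \<phi> (x - lattice_point m)) + ennreal (norm \<mu> powr p) * E x"
    using AE_lattice_translates_support[OF supp]
  proof eventually_elim
    case (elim x)
    let ?H = "of_bool (lattice_floor x \<in> I) :: complex"
    let ?P = "lattice_sum \<phi> x"
    have fin: "finite {k. \<phi> (x - lattice_point k) \<noteq> 0}"
      by (rule finite_subset[OF _ finite_lattice_points_cball[of x R]]) (use elim in force)
    \<comment> \<open>Enlarging by \<open>I\<close> allows both sums to be compared over one finite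
      set.\<close>
    define F where "F = {k. \<phi> (x - lattice_point k) \<noteq> 0} \<union> I"
    have F: "finite F" "I \<subseteq> F" using fin I by (auto simp: F_def)
    have inf: "(\<Sum>\<^sub>\<infinity>k. g k * \<phi> (x - lattice_point k)) = (\<Sum>k\<in>F. g k * \<phi> (x - lattice_point k))" for g
    proof -
      have "(\<Sum>\<^sub>\<infinity>k. g k * \<phi> (x - lattice_point k)) = (\<Sum>\<^sub>\<infinity>k\<in>F. g k * \<phi> (x - lattice_point k))"
        by (intro infsum_cong_neutral) (auto simp: F_def)
      then show ?thesis using F by simp
    qed
    have "(\<Sum>k\<in>I. \<phi> (x - lattice_point k)) = (\<Sum>k\<in>F. of_bool (k \<in> I) * \<phi> (x - lattice_point k))"
      using F by (intro sum.mono_neutral_cong_left) auto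
    moreover have "?P = (\<Sum>k\<in>F. \<phi> (x - lattice_point k))"
      using inf[of "\<lambda>_. 1"] by (simp add: lattice_sum_def)
    ultimately have "?H * ?P - (\<Sum>k\<in>I. \<phi> (x - lattice_point k)) = (\<Sum>k\<in>F. h k x * \<phi> (x - lattice_point k))"
      by (simp add: h_def sum_distrib_left left_diff_distrib sum_subtractf)
    also have "\<dots> = (\<Sum>\<^sub>\<infinity>k. h k x * \<phi> (x - lattice_point k))"
      by (rule inf[symmetric])
    finally have eq: "?H - \<mu> * (\<Sum>k\<in>I. \<phi> (x - lattice_point k)) = ?H * (1 - \<mu> * ?P) + \<mu> * (\<Sum>\<^sub>\<infinity>k. h k x * \<phi> (x - lattice_point k))"
      by (simp add: algebra_simps flip: \<open>_ = infsum _ _\<close>)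
    have "ennreal (norm (?H - \<mu> * (\<Sum>k\<in>I. \<phi> (x - lattice_point k))) powr p)
        \<le> ennreal (norm (?H * (1 - \<mu> * ?P)) powr p) + ennreal (norm (\<mu> * (\<Sum>\<^sub>\<infinity>k. h k x * \<phi> (x - lattice_point k))) powr p)"
      unfolding eq by (simp only: ennreal_plus[symmetric] powr_ge_zero) (intro ennreal_leI norm_add_powr_le[OF p])
    \<comment> \<open>The translates of the cube tile, so at most the term
      \<open>m = lattice_floor x\<close> survives, and there periodicity gives
      \<open>lattice_sum\<close> its value at x.\<close>
    also have "ennreal (norm (?H * (1 - \<mu> * ?P)) powr p) = (\<Sum>m\<in>I. cube_deviation p \<mu> \<phi> (x - lattice_point m))"
    proof (cases "lattice_floor x \<in> I")
      case True
      then show ?thesis using I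
        by (subst sum.remove[of _ "lattice_floor x"])
          (auto simp: cube_deviation_def lattice_sum_periodic unit_cube_eq lattice_floor_diff indicator_def intro!: sum.neutral[symmetric] split: if_splits)
    next
      case False
      then have "cube_deviation p \<mu> \<phi> (x - lattice_point m) = 0" if "m \<in> I" for m
        using that by (auto simp: cube_deviation_def unit_cube_eq lattice_floor_diff indicator_def)
      then show ?thesis using False by simp
    qed
    also have "ennreal (norm (\<mu> * (\<Sum>\<^sub>\<infinity>k. h k x * \<phi> (x - lattice_point k))) powr p)
        = ennreal (norm \<mu> powr p) * ennreal (norm (\<Sum>\<^sub>\<infinity>k. h k x * \<phi> (x - lattice_point k)) powr p)"
      by (simp add: norm_mult powr_mult ennreal_mult)
    also have "\<dots> \<le> ennreal (norm \<mu> powr p) * lp_mass p UNIV (\<lambda>k. h k x * \<phi> (x - lattice_point k))"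
      by (intro mult_left_mono norm_infsum_powr_le p) auto
    also have "lp_mass p UNIV (\<lambda>k. h k x * \<phi> (x - lattice_point k)) = E x"
      unfolding lp_mass_def E_def by (intro nn_integral_cong) (auto simp: h_def)
    finally show ?case by (simp add: add_left_mono)
  qed
  then have "Lp_mass p (\<lambda>x. of_bool (lattice_floor x \<in> I) - \<mu> * (\<Sum>k\<in>I. \<phi> (x - lattice_point k)))
      \<le> (\<integral>\<^sup>+x. (\<Sum>m\<in>I. cube_deviation p \<mu> \<phi> (x - lattice_point m)) + ennreal (norm \<mu> powr p) * E x \<partial>lebesgue)"
    unfolding Lp_mass_def by (rule nn_integral_mono_AE)
  also have "\<dots> = (\<Sum>m\<in>I. \<integral>\<^sup>+x. cube_deviation p \<mu> \<phi> (x - lattice_point m) \<partial>lebesgue) + ennreal (norm \<mu> powr p) * (\<integral>\<^sup>+x. E x \<partial>lebesgue)"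
    by (simp add: nn_integral_add nn_integral_cmult nn_integral_sum)
  also have "(\<Sum>m\<in>I. \<integral>\<^sup>+x. cube_deviation p \<mu> \<phi> (x - lattice_point m) \<partial>lebesgue) = of_nat (card I) * (\<integral>\<^sup>+x. cube_deviation p \<mu> \<phi> x \<partial>lebesgue)"
    by (simp add: nn_integral_minus_lebesgue[OF measurable_cube_deviation[OF supp meas]])
  also have "(\<integral>\<^sup>+x. E x \<partial>lebesgue) \<le> 2 * of_nat (card (lattice_boundary (R + real CARD('d)) I)) * Lp_mass p \<phi>"
  proof -
    have "(\<integral>\<^sup>+x. E x \<partial>lebesgue) = (\<integral>\<^sup>+k. \<integral>\<^sup>+x. of_bool ((lattice_floor x \<in> I) \<noteq> (k \<in> I)) * ennreal (norm (\<phi> (x - lattice_point k)) powr p) \<partial>lebesgue \<partial>count_space UNIV)"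
      unfolding E_def by (intro nn_integral_count_space_nn_integral) auto
    \<comment> \<open>The substitution makes every term carry the same factor in \<phi>; exchanging
      the integrals again leaves a count of those \<open>k\<close> for which \<open>I\<close> and
      its shift by \<open>lattice_floor x\<close> disagree.\<close>
    also have "\<dots> = (\<integral>\<^sup>+k. \<integral>\<^sup>+x. of_bool ((lattice_floor x + k \<in> I) \<noteq> (k \<in> I)) * ennreal (norm (\<phi> x) powr p) \<partial>lebesgue \<partial>count_space UNIV)"
    proof (rule nn_integral_cong)
      fix k
      have "(\<integral>\<^sup>+x. of_bool ((lattice_floor (x - lattice_point k) + k \<in> I) \<noteq> (k \<in> I)) * ennreal (norm (\<phi> (x - lattice_point k)) powr p) \<partial>lebesgue)
        = (\<integral>\<^sup>+x. of_bool ((lattice_floor x + k \<in> I) \<noteq> (k \<in> I)) * ennreal (norm (\<phi> x) powr p) \<partial>lebesgue)"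
        by (rule nn_integral_minus_lebesgue[of "\<lambda>x. of_bool ((lattice_floor x + k \<in> I) \<noteq> (k \<in> I)) * ennreal (norm (\<phi> x) powr p)"]) measurable
      then show "(\<integral>\<^sup>+x. of_bool ((lattice_floor x \<in> I) \<noteq> (k \<in> I)) * ennreal (norm (\<phi> (x - lattice_point k)) powr p) \<partial>lebesgue)
        = (\<integral>\<^sup>+x. of_bool ((lattice_floor x + k \<in> I) \<noteq> (k \<in> I)) * ennreal (norm (\<phi> x) powr p) \<partial>lebesgue)"
        by (simp add: lattice_floor_diff)
    qed
    also have "\<dots> = (\<integral>\<^sup>+x. \<integral>\<^sup>+k. of_bool ((lattice_floor x + k \<in> I) \<noteq> (k \<in> I)) * ennreal (norm (\<phi> x) powr p) \<partial>count_space UNIV \<partial>lebesgue)"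
      by (intro nn_integral_count_space_nn_integral[symmetric]) auto
    also have "\<dots> = (\<integral>\<^sup>+x. (\<integral>\<^sup>+k. of_bool ((lattice_floor x + k \<in> I) \<noteq> (k \<in> I)) \<partial>count_space UNIV) * ennreal (norm (\<phi> x) powr p) \<partial>lebesgue)"
      by (intro nn_integral_cong nn_integral_multc) auto
    also have "\<dots> \<le> (\<integral>\<^sup>+x. 2 * of_nat (card (lattice_boundary (R + real CARD('d)) I)) * ennreal (norm (\<phi> x) powr p) \<partial>lebesgue)"
      using supp
    proof (intro nn_integral_mono_AE, eventually_elim)
      case (elim x)
      show ?case
      proof (cases "R < norm x")
        case False
        \<comment> \<open>Where \<phi> does not vanish, the shift has length at most
          \<open>R\<close> plus the cell bound; this is the origin of the boundary radius.\<close>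
        have "norm (lattice_point (lattice_floor x) :: real ^ 'd) \<le> norm x + norm (x - lattice_point (lattice_floor x))"
          using norm_triangle_ineq4[of x "x - lattice_point (lattice_floor x)"] by simp
        then have "norm (lattice_point (lattice_floor x) :: real ^ 'd) \<le> R + real CARD('d)"
          using norm_minus_lattice_floor[of x] False by linarith
        then show ?thesis by (intro mult_right_mono nn_integral_shift_difference_le I) auto
      qed (use elim in auto)
    qed
    also have "\<dots> = 2 * of_nat (card (lattice_boundary (R + real CARD('d)) I)) * Lp_mass p \<phi>"
      by (simp add: nn_integral_cmult Lp_mass_def)
    finally show ?thesis .
  qed
  finally show ?thesis by (simp add: add_left_mono mult_left_mono)
qed

section \<open>Affine systems\<close>

text \<open>The complement of the support is a possibly uncountable union of open sets on which
  \<psi> vanishes almost everywhere; Lindelof reduces it to a countable one.\<close>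

lemma AE_not_in_ess_support:
  fixes \<psi> :: "real ^ 'd \<Rightarrow> complex"
  shows "AE x in lebesgue. x \<notin> ess_support \<psi> \<longrightarrow> \<psi> x = 0"
proof -
  define \<F> where "\<F> = {U. open U \<and> (AE x in lebesgue. x \<in> U \<longrightarrow> \<psi> x = 0)}"
  obtain \<G> where G: "\<G> \<subseteq> \<F>" "countable \<G>" "\<Union>\<G> = \<Union>\<F>"
    using Lindelof[of \<F>] unfolding \<F>_def by auto
  have "AE x in lebesgue. \<forall>U\<in>\<G>. x \<in> U \<longrightarrow> \<psi> x = 0"
    using G(1,2) by (subst AE_ball_countable) (auto simp: \<F>_def)
  then show ?thesis
    by eventually_elim (use G(3) in \<open>auto simp: ess_support_def \<F>_def\<close>)
qed

lemma AE_matrix_vector_mult: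
  fixes T :: "real ^ 'd ^ 'd"
  assumes T: "invertible T" and P: "AE x in lebesgue. P x"
  shows "AE x in lebesgue. P (T *v x)"
proof -
  obtain N where N: "N \<in> null_sets lebesgue" "{x. \<not> P x} \<subseteq> N"
    using P by (auto simp: completion.AE_iff_null_sets)
  then have "(*v) T -` N \<in> null_sets lebesgue"
    using matrix_vimage_lebesgue[OF T, of N] by (auto simp: null_sets_def)
  then show ?thesis by (rule AE_I') (use N in auto)
qed

lemma Lp_mass_matrix_vector_mult:
  fixes T :: "real ^ 'd ^ 'd"
  assumes T: "invertible T" and f: "f \<in> borel_measurable lebesgue"
  shows "Lp_mass p (\<lambda>x. f (T *v x)) = ennreal (1 / \<bar>det T\<bar>) * Lp_mass p f"
  using f nn_integral_matrix_vector_mult[OF T, of "\<lambda>x. ennreal (norm (f x) powr p)"]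
  by (simp add: Lp_mass_def)

lemma Lp_mass_indicator:
  assumes "0 < p" "K \<in> sets lebesgue"
  shows "Lp_mass p (indicator K) = emeasure lebesgue K"
proof -
  have "ennreal (norm (indicator K x :: complex) powr p) = indicator K x" for x
    using assms(1) by (simp add: indicator_def)
  then show ?thesis using assms(2) by (simp add: Lp_mass_def)
qed

lemma synthesis_finite_sum:
  assumes "finite F" "F \<subseteq> {0<..} \<times> UNIV" "\<And>j k. 0 < j \<Longrightarrow> c j k \<noteq> 0 \<Longrightarrow> (j, k) \<in> F"
  shows "synthesis p a b \<psi> c x = (\<Sum>(j, k)\<in>F. c j k * affine_function p a b \<psi> j k x)"
proof -
  have "synthesis p a b \<psi> c x = (\<Sum>\<^sub>\<infinity>(j, k)\<in>F. c j k * affine_function p a b \<psi> j k x)"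
    unfolding synthesis_def using assms by (intro infsum_cong_neutral) (auto split: prod.splits)
  then show ?thesis using assms(1) by simp
qed

text \<open>\<open>R\<close> bounds the support in lattice coordinates, after composition with
  \<open>b\<close>, so that every atom lives in a ball of radius \<open>R\<close> around a lattice
  point.\<close>

locale affine_system =
  fixes p :: real and a :: "nat \<Rightarrow> real ^ 'd ^ 'd" and b :: "real ^ 'd ^ 'd"
    and \<psi> :: "real ^ 'd \<Rightarrow> complex" and R :: real
  assumes p: "0 < p" "p \<le> 1"
    and b: "invertible b"
    and \<psi>_measurable [measurable]: "\<psi> \<in> borel_measurable lebesgue"
    and \<psi>_mass: "Lp_mass p \<psi> < \<infinity>"
    and R: "0 \<le> R" "AE x in lebesgue. R < norm x \<longrightarrow> \<psi> (b *v x) = 0"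
    and a: "\<And>j. 0 < j \<Longrightarrow> invertible (a j)"
    and a_lim: "(\<lambda>j. onorm (\<lambda>x. matrix_inv (a j) *v x)) \<longlonglongrightarrow> 0"
begin

abbreviation S where "S \<equiv> synthesis p a b \<psi>"

abbreviation affine where "affine \<equiv> affine_function p a b \<psi>"

abbreviation mass where "mass c \<equiv> lp_mass p ({0<..} \<times> UNIV) (case_prod c)"

definition \<phi> where "\<phi> x = \<psi> (b *v x)"

text \<open>Finiteness makes the synthesis a finite sum at every point. Scale 0 is excluded
  explicitly because the finiteness condition ranges over all natural scales, while
  \<open>a 0\<close> is arbitrary.\<close>

definition admissible :: "(real ^ 'd) set \<Rightarrow> (nat \<Rightarrow> int ^ 'd \<Rightarrow> complex) \<Rightarrow> bool" where
  "admissible \<Omega> c \<longleftrightarrow> finite {(j, k). c j k \<noteq> 0} \<and> (\<forall>k. c 0 k = 0) \<and> adapted p a b \<Omega> \<psi> c"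

text \<open>In the coordinates \<open>x = T *v y\<close> the atoms of scale \<open>j\<close> become
  integer translates of one function, so estimates can be made on the unit lattice.\<close>

lemma affine_compose:
  assumes j: "0 < j"
  defines "T \<equiv> matrix_inv (a j) ** b"
  shows "affine j k (T *v y) = of_real (\<bar>det (a j)\<bar> powr (1 / p)) * \<phi> (y - lattice_point k)"
proof -
  have "a j *v (T *v y) = b *v y"
    unfolding T_def using matrix_inv_vector_mult(1)[OF a[OF j]] by (simp flip: matrix_vector_mul_assoc)
  then show ?thesis by (simp add: affine_function_def \<phi>_def matrix_vector_mult_diff_distrib)
qed

lemma \<phi>_measurable [measurable]: "\<phi> \<in> borel_measurable lebesgue"
  unfolding \<phi>_def using measurable_compose[OF measurable_matrix_vector_mult_lebesgue[OF b] \<psi>_measurable] .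

lemma \<phi>_mass: "Lp_mass p \<phi> < \<infinity>"
  using \<psi>_mass Lp_mass_matrix_vector_mult[OF b \<psi>_measurable, of p]
  by (simp add: \<phi>_def[abs_def] ennreal_mult_less_top)

lemma measurable_affine: "0 < j \<Longrightarrow> affine j k \<in> borel_measurable lebesgue"
proof -
  assume j: "0 < j"
  have [measurable]: "(\<lambda>x. \<psi> (a j *v (x - matrix_inv (a j) *v (b *v lattice_point k)))) \<in> borel_measurable lebesgue"
    using measurable_translate_lebesgue[OF measurable_compose[OF measurable_matrix_vector_mult_lebesgue[OF a[OF j]] \<psi>_measurable]] .
  have "a j *v (x - matrix_inv (a j) *v (b *v lattice_point k)) = a j *v x - b *v lattice_point k" for x
    by (simp add: matrix_vector_mult_diff_distrib matrix_inv_vector_mult[OF a[OF j]])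
  then have "affine j k = (\<lambda>x. of_real (\<bar>det (a j)\<bar> powr (1 / p)) * \<psi> (a j *v (x - matrix_inv (a j) *v (b *v lattice_point k))))"
    by (simp add: affine_function_def fun_eq_iff)
  then show ?thesis by simp
qed

lemma invertible_scale:
  assumes "0 < j"
  shows "invertible (matrix_inv (a j) ** b)" "det (matrix_inv (a j) ** b) = det b / det (a j)"
    "det (a j) \<noteq> 0" "det b \<noteq> 0"
proof -
  show d: "det (a j) \<noteq> 0" "det b \<noteq> 0" using a[OF assms] b by (auto simp: invertible_det_nz)
  have "det (a j) * det (matrix_inv (a j)) = 1"
    using matrix_inv_mult(1)[OF a[OF assms]] by (metis det_mul det_I)
  then have "det (matrix_inv (a j)) = 1 / det (a j)" using d by (simp add: field_simps)
  then show "det (matrix_inv (a j) ** b) = det b / det (a j)" by (simp add: det_mul)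
  then show "invertible (matrix_inv (a j) ** b)" using d by (simp add: invertible_det_nz)
qed

lemma exists_fine_scale:
  assumes "0 < \<eta>"
  obtains j where "0 < j" "\<And>y. norm y \<le> r \<Longrightarrow> norm ((matrix_inv (a j) ** b) *v y) \<le> \<eta>"
proof -
  have bl: "bounded_linear ((*v) A)" for A :: "real ^ 'd ^ 'd" by simp
  \<comment> \<open>Adding 1 to each factor makes \<open>B\<close> positive without further
    argument.\<close>
  define B where "B = (onorm ((*v) b) + 1) * (\<bar>r\<bar> + 1)"
  have B: "0 < B" using onorm_pos_le[OF bl, of b] by (simp add: B_def)
  have "eventually (\<lambda>j. onorm (\<lambda>x. matrix_inv (a j) *v x) < \<eta> / B) sequentially"
    using a_lim assms B by (intro order_tendstoD) auto
  then have "eventually (\<lambda>j. onorm (\<lambda>x. matrix_inv (a j) *v x) < \<eta> / B \<and> 0 < j) sequentially"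
    using eventually_gt_at_top by (rule eventually_conj)
  then obtain j where j: "onorm (\<lambda>x. matrix_inv (a j) *v x) < \<eta> / B" "0 < j"
    by (auto dest: eventually_happens)
  have "norm ((matrix_inv (a j) ** b) *v y) \<le> \<eta>" if "norm y \<le> r" for y
  proof -
    have "norm (b *v y) \<le> onorm ((*v) b) * norm y" by (rule onorm[OF bl])
    also have "\<dots> \<le> B" unfolding B_def
      using that onorm_pos_le[OF bl, of b] by (intro mult_mono) auto
    finally have bw: "norm (b *v y) \<le> B" .
    have "norm ((matrix_inv (a j) ** b) *v y) \<le> onorm ((*v) (matrix_inv (a j))) * norm (b *v y)"
      using onorm[OF bl] by (simp flip: matrix_vector_mul_assoc)
    also have "\<dots> \<le> \<eta> / B * B"
      using j bw B assms by (intro mult_mono) (auto intro: less_imp_le onorm_pos_le bl)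
    finally show ?thesis using B by simp
  qed
  then show ?thesis using j(2) that by blast
qed

text \<open>The points whose lattice coordinate is farther than \<open>R\<close> from
  \<open>k\<close> form an open set on which the atom vanishes almost everywhere, so the essential
  support misses it.\<close>

lemma ess_support_affine:
  assumes j: "0 < j" and x: "x \<in> ess_support (affine j k)"
  obtains y where "x = (matrix_inv (a j) ** b) *v y" "norm (y - lattice_point k) \<le> R"
proof -
  let ?T = "matrix_inv (a j) ** b"
  let ?Ti = "matrix_inv ?T"
  note T = invertible_scale(1)[OF j]
  have Ti: "invertible ?Ti" using matrix_inv_mult[OF T] invertible_def by blast
  define U where "U = {x. R < norm (?Ti *v x - lattice_point k)}"
  have "open U" unfolding U_def
    by (intro open_Collect_less continuous_intros matrix_vector_mult_linear_continuous_on)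
  moreover have "AE x in lebesgue. x \<in> U \<longrightarrow> affine j k x = 0"
    using AE_matrix_vector_mult[OF Ti AE_minus_lebesgue[OF R(2), of "lattice_point k"]]
  proof eventually_elim
    case (elim x)
    then show ?case using affine_compose[OF j, of k "?Ti *v x"] matrix_inv_vector_mult(1)[OF T]
      by (simp add: U_def \<phi>_def)
  qed
  ultimately have "x \<notin> U" using x by (auto simp: ess_support_def)
  then show ?thesis using that[of "?Ti *v x"] matrix_inv_vector_mult(1)[OF T] by (simp add: U_def)
qed

text \<open>The three terms of the error are the part of the cells sticking out of \<open>K\<close>,
  the deviation \<theta> per unit volume of cells, and the interaction across the boundary of the
  union of cells.\<close>

lemma indicator_approximable:
  assumes K: "compact K" "K \<subseteq> \<Omega>" and \<Omega>: "open \<Omega>"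
    and dev: "(\<integral>\<^sup>+x. cube_deviation p \<mu> \<phi> x \<partial>lebesgue) = \<theta>" and \<delta>: "0 < \<delta>"
  obtains c where "admissible \<Omega> c"
    "Lp_mass p (\<lambda>x. indicator K x - S c x) \<le>
      ennreal \<delta> + (\<theta> * (emeasure lebesgue K + ennreal \<delta>) + ennreal (norm \<mu> powr p) * (2 * ennreal \<delta> * Lp_mass p \<phi>))"
    "mass c \<le> ennreal (norm \<mu> powr p / \<bar>det b\<bar>) * (emeasure lebesgue K + ennreal \<delta>)"
proof -
  have Kl: "K \<in> sets lebesgue" using K(1) by (simp add: lmeasurable_compact fmeasurableD)
  obtain U where U: "open U" "K \<subseteq> U" "emeasure lebesgue (U - K) < ennreal \<delta>"
    using sets_lebesgue_outer_open[OF Kl \<delta>] by metis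
  \<comment> \<open>Containment in \<Omega> will give adaptedness, and the small measure of
    \<open>V - K\<close> will bound all boundary errors.\<close>
  define V where "V = U \<inter> \<Omega>"
  have V: "open V" "K \<subseteq> V" "V \<subseteq> \<Omega>" using U K \<Omega> by (auto simp: V_def)
  then have Vl: "V \<in> sets lebesgue" by simp
  have "emeasure lebesgue (V - K) \<le> emeasure lebesgue (U - K)"
    using U(1) Kl by (intro emeasure_mono) (auto simp: V_def)
  then have VK: "emeasure lebesgue (V - K) \<le> ennreal \<delta>" using U(3) by auto
  have eV: "emeasure lebesgue V \<le> emeasure lebesgue K + ennreal \<delta>"
  proof -
    have "emeasure lebesgue V = emeasure lebesgue (K \<union> (V - K))" using V(2) by (simp add: Un_absorb1)
    also have "\<dots> = emeasure lebesgue K + emeasure lebesgue (V - K)"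
      using Kl Vl by (intro plus_emeasure[symmetric]) auto
    finally show ?thesis using VK by (simp only: add_left_mono)
  qed
  obtain \<eta> where \<eta>: "0 < \<eta>" "(\<Union>x\<in>K. cball x \<eta>) \<subseteq> V"
    using compact_subset_open_imp_cball_epsilon_subset[OF K(1) V(1,2)] by metis
  define d where "d = real CARD('d)"
  have d: "0 \<le> d" by (simp add: d_def)
  \<comment> \<open>The radius is the largest distance that occurs: \<open>R + d\<close> between
    lattice points of \<open>B\<close> and \<open>I\<close>, plus \<open>d\<close> at each end for
    the position inside the cell.\<close>
  obtain j where j: "0 < j" and fine: "\<And>y. norm y \<le> R + 3 * d \<Longrightarrow> norm ((matrix_inv (a j) ** b) *v y) \<le> \<eta>"
    using exists_fine_scale[OF \<eta>(1), of "R + 3 * d"] by metis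
  define T where "T = matrix_inv (a j) ** b"
  note T = invertible_scale(1)[OF j, folded T_def]
  have detT: "0 < \<bar>det T\<bar>" using T by (simp add: invertible_det_nz)
  note [measurable] = measurable_matrix_vector_mult_lebesgue[OF T]
  have near: "T *v y \<in> V" if "T *v y' \<in> K" "norm (y - y') \<le> R + 3 * d" for y y'
  proof -
    have "norm (T *v (y - y')) \<le> \<eta>" unfolding T_def by (rule fine) fact
    then have "T *v y \<in> cball (T *v y') \<eta>"
      by (simp add: matrix_vector_mult_diff_distrib dist_norm norm_minus_commute)
    then show ?thesis using \<eta>(2) that(1) by blast
  qed
  define I where "I = lattice_floor ` {y. T *v y \<in> K}"
  have finI: "finite I"
  proof -
    have "bounded ((*v) (matrix_inv T) ` K)"
      by (intro compact_imp_bounded compact_continuous_image K(1) matrix_vector_mult_linear_continuous_on)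
    then obtain L where L: "\<And>y. y \<in> (*v) (matrix_inv T) ` K \<Longrightarrow> norm y \<le> L" by (auto simp: bounded_iff)
    have "norm (0 - lattice_point (lattice_floor y) :: real ^ 'd) \<le> L + d" if "T *v y \<in> K" for y
    proof -
      have "norm y \<le> L" using L[of y] that matrix_inv_vector_mult(2)[OF T, of y] by (metis image_eqI)
      then show ?thesis
        using norm_minus_lattice_floor[of y] norm_triangle_ineq4[of y "y - lattice_point (lattice_floor y)"]
        by (simp add: d_def)
    qed
    then have "I \<subseteq> {k. norm (0 - lattice_point k :: real ^ 'd) \<le> L + d}" by (auto simp: I_def)
    then show ?thesis by (rule finite_subset) (rule finite_lattice_points_cball)
  qed
  have cell: "norm (y - y') \<le> r + 2 * d"
    if "norm (lattice_point (lattice_floor y) - lattice_point (lattice_floor y') :: real ^ 'd) \<le> r" for y y' r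
  proof -
    let ?u = "y - lattice_point (lattice_floor y)"
    let ?v = "lattice_point (lattice_floor y) - lattice_point (lattice_floor y') :: real ^ 'd"
    let ?w = "y' - lattice_point (lattice_floor y')"
    have eq: "y - y' = ?u + (?v - ?w)" by simp
    have "norm (y - y') \<le> norm ?u + (norm ?v + norm ?w)"
      unfolding eq using norm_triangle_ineq[of ?u "?v - ?w"] norm_triangle_ineq4[of ?v ?w] by linarith
    then show ?thesis
      using that norm_minus_lattice_floor[of y] norm_minus_lattice_floor[of y'] by (simp add: d_def)
  qed
  \<comment> \<open>Cells have volume 1, so counting them is measuring their union, which
    \<open>T\<close> maps into \<open>X\<close>.\<close>
  have card_le: "of_nat (card J) \<le> ennreal (1 / \<bar>det T\<bar>) * emeasure lebesgue X"
    if "finite J" "X \<in> sets lebesgue" "\<And>y. lattice_floor y \<in> J \<Longrightarrow> T *v y \<in> X" for J X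
  proof -
    have "of_nat (card J) = emeasure lebesgue {y. lattice_floor y \<in> J}"
      using that(1) by (simp only: emeasure_lattice_floor_vimage)
    also have "\<dots> \<le> emeasure lebesgue ((*v) T -` X)"
      using that(3) matrix_vimage_lebesgue(1)[OF T that(2)] by (intro emeasure_mono) auto
    finally show ?thesis by (simp only: matrix_vimage_lebesgue(2)[OF T that(2)])
  qed
  define B where "B = lattice_boundary (R + d) I"
  have inI: "T *v y \<in> V" if I: "lattice_floor y \<in> I" for y
  proof -
    obtain y' where y': "lattice_floor y = lattice_floor y'" "T *v y' \<in> K"
      using I by (auto simp: I_def)
    then show ?thesis using cell[of y y' 0] R(1) d by (intro near[of y']) auto
  qed
  \<comment> \<open>\<open>I\<close> has every cell that meets the preimage of \<open>K\<close>, so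
    a cell outside \<open>I\<close> misses it altogether; boundary cells therefore fit into
    \<open>V - K\<close>.\<close>
  have inB: "T *v y \<in> V - K" if B: "lattice_floor y \<in> B" for y
  proof -
    obtain y' where y': "norm (lattice_point (lattice_floor y) - lattice_point (lattice_floor y') :: real ^ 'd) \<le> R + d" "T *v y' \<in> K"
      using B unfolding I_def B_def lattice_boundary_def by blast
    have "T *v y \<in> V" using cell[OF y'(1)] y'(2) by (intro near[of y']) auto
    moreover have "T *v y \<notin> K" using B by (auto simp: I_def B_def lattice_boundary_def)
    ultimately show ?thesis by simp
  qed
  have cardI: "ennreal \<bar>det T\<bar> * of_nat (card I) \<le> emeasure lebesgue K + ennreal \<delta>"
  proof -
    have "ennreal \<bar>det T\<bar> * of_nat (card I) \<le> ennreal \<bar>det T\<bar> * (ennreal (1 / \<bar>det T\<bar>) * emeasure lebesgue V)"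
      by (intro mult_left_mono card_le finI Vl inI) auto
    also have "\<dots> = emeasure lebesgue V"
      using detT by (simp add: mult.assoc[symmetric] ennreal_mult[symmetric])
    finally show ?thesis using eV by (rule order_trans)
  qed
  have cardB: "ennreal \<bar>det T\<bar> * of_nat (card B) \<le> ennreal \<delta>"
  proof -
    have "ennreal \<bar>det T\<bar> * of_nat (card B) \<le> ennreal \<bar>det T\<bar> * (ennreal (1 / \<bar>det T\<bar>) * emeasure lebesgue (V - K))"
      using finite_lattice_boundary[OF finI] Vl Kl
      by (intro mult_left_mono card_le inB) (auto simp: B_def)
    also have "\<dots> = emeasure lebesgue (V - K)"
      using detT by (simp add: mult.assoc[symmetric] ennreal_mult[symmetric])
    finally show ?thesis using VK by (rule order_trans)
  qed
  define s where "s = \<bar>det (a j)\<bar> powr (1 / p)"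
  have s: "0 < s" "s powr p = \<bar>det (a j)\<bar>"
    using invertible_scale(3)[OF j] p by (simp_all add: s_def powr_powr)
  \<comment> \<open>Division by \<open>s\<close> cancels the normalising factor of the atoms and
    leaves \<mu> times a plain lattice sum over \<open>I\<close>.\<close>
  define c where "c = (\<lambda>i k. if i = j \<and> k \<in> I then \<mu> / of_real s else 0)"
  have c_nz: "i = j \<and> k \<in> I" if "c i k \<noteq> 0" for i k
    using that by (auto simp: c_def split: if_split_asm)
  have S_eq: "S c x = (\<Sum>k\<in>I. \<mu> / of_real s * affine j k x)" for x
  proof -
    have "S c x = (\<Sum>(i, k)\<in>{j} \<times> I. c i k * affine i k x)"
      by (rule synthesis_finite_sum) (use finI j in \<open>auto simp: c_def split: if_splits\<close>)
    then show ?thesis by (simp add: sum.cartesian_product[symmetric] c_def)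
  qed
  then have S_T: "S c (T *v y) = \<mu> * (\<Sum>k\<in>I. \<phi> (y - lattice_point k))" for y
    using s affine_compose[OF j, folded T_def s_def] by (simp add: sum_distrib_left)
  have S_meas [measurable]: "S c \<in> borel_measurable lebesgue"
    unfolding S_eq[abs_def] using measurable_affine[OF j] by measurable
  have K_meas [measurable]: "(indicator K :: _ \<Rightarrow> complex) \<in> borel_measurable lebesgue"
    using Kl by simp
  have [measurable]: "(\<lambda>y. indicator K (T *v y) :: complex) \<in> borel_measurable lebesgue"
    using measurable_compose[OF measurable_matrix_vector_mult_lebesgue[OF T] K_meas] .
  have [measurable]: "(\<lambda>y. of_bool (lattice_floor y \<in> I) :: complex) \<in> borel_measurable lebesgue"
    using measurable_compose[OF measurable_lattice_floor, of "\<lambda>k. of_bool (k \<in> I)"] by simp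
  note [measurable] = measurable_translate_lebesgue[OF \<phi>_measurable]
  let ?F = "\<lambda>x. indicator K x - S c x"
  let ?H = "\<lambda>y. of_bool (lattice_floor y \<in> I) :: complex"
  have "Lp_mass p (\<lambda>y. ?F (T *v y)) = ennreal (1 / \<bar>det T\<bar>) * Lp_mass p ?F"
    by (rule Lp_mass_matrix_vector_mult[OF T]) measurable
  then have "Lp_mass p ?F = ennreal \<bar>det T\<bar> * Lp_mass p (\<lambda>y. ?F (T *v y))"
    using detT by (simp add: mult.assoc[symmetric] ennreal_mult[symmetric])
  also have "Lp_mass p (\<lambda>y. ?F (T *v y)) =
      Lp_mass p (\<lambda>y. (indicator K (T *v y) - ?H y) + (?H y - \<mu> * (\<Sum>k\<in>I. \<phi> (y - lattice_point k))))"
    by (simp add: S_T)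
  also have "\<dots> \<le> Lp_mass p (\<lambda>y. indicator K (T *v y) - ?H y)
      + Lp_mass p (\<lambda>y. ?H y - \<mu> * (\<Sum>k\<in>I. \<phi> (y - lattice_point k)))"
    by (intro Lp_mass_add p) measurable
  \<comment> \<open>The cells of \<open>I\<close> cover the preimage of \<open>K\<close> and stay in
    that of \<open>V\<close>, so the two functions differ only over \<open>V - K\<close>.\<close>
  also have "Lp_mass p (\<lambda>y. indicator K (T *v y) - ?H y) \<le> Lp_mass p (\<lambda>y. indicator (V - K) (T *v y))"
    unfolding Lp_mass_def
  proof (intro nn_integral_mono ennreal_leI powr_mono2)
    fix y
    show "norm (indicator K (T *v y) - ?H y) \<le> norm (indicator (V - K) (T *v y) :: complex)"
      using inI[of y] by (auto simp: indicator_def I_def)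
  qed (use p in auto)
  also have "\<dots> = ennreal (1 / \<bar>det T\<bar>) * emeasure lebesgue (V - K)"
    using Lp_mass_matrix_vector_mult[OF T, of "indicator (V - K)" p] Lp_mass_indicator[of p "V - K"] p Kl Vl
    by simp
  also have "Lp_mass p (\<lambda>y. ?H y - \<mu> * (\<Sum>k\<in>I. \<phi> (y - lattice_point k)))
      \<le> of_nat (card I) * \<theta> + ennreal (norm \<mu> powr p) * (2 * of_nat (card B) * Lp_mass p \<phi>)"
    using Lp_mass_lattice_approx[OF p R(2)[folded \<phi>_def] \<phi>_measurable finI, of \<mu>]
    by (simp only: dev B_def d_def)
  finally have "Lp_mass p ?F \<le> ennreal \<bar>det T\<bar> * (ennreal (1 / \<bar>det T\<bar>) * emeasure lebesgue (V - K)
      + (of_nat (card I) * \<theta> + ennreal (norm \<mu> powr p) * (2 * of_nat (card B) * Lp_mass p \<phi>)))"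
    by (simp add: mult_left_mono add_right_mono add_left_mono)
  also have "\<dots> = emeasure lebesgue (V - K) + (\<theta> * (ennreal \<bar>det T\<bar> * of_nat (card I))
      + ennreal (norm \<mu> powr p) * (2 * (ennreal \<bar>det T\<bar> * of_nat (card B)) * Lp_mass p \<phi>))"
  proof -
    have "ennreal \<bar>det T\<bar> * (ennreal (1 / \<bar>det T\<bar>) * emeasure lebesgue (V - K)) = emeasure lebesgue (V - K)"
      using detT by (simp add: mult.assoc[symmetric] ennreal_mult[symmetric])
    then show ?thesis by (simp only: distrib_left ac_simps)
  qed
  also have "\<dots> \<le> ennreal \<delta> + (\<theta> * (emeasure lebesgue K + ennreal \<delta>) + ennreal (norm \<mu> powr p) * (2 * ennreal \<delta> * Lp_mass p \<phi>))"
    by (intro add_mono mult_mono VK cardI cardB) auto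
  finally have F: "Lp_mass p ?F \<le> ennreal \<delta> + (\<theta> * (emeasure lebesgue K + ennreal \<delta>) + ennreal (norm \<mu> powr p) * (2 * ennreal \<delta> * Lp_mass p \<phi>))" .
  have "mass c = (\<Sum>i\<in>{j} \<times> I. ennreal (norm (case_prod c i) powr p))"
    by (rule lp_mass_finite_sum) (use finI j c_nz in auto)
  also have "\<dots> = of_nat (card I) * ennreal (norm \<mu> powr p / \<bar>det (a j)\<bar>)"
    using s by (simp add: sum.cartesian_product' c_def norm_divide powr_divide)
  also have "\<dots> = ennreal (norm \<mu> powr p / \<bar>det b\<bar>) * (ennreal \<bar>det T\<bar> * of_nat (card I))"
  proof -
    \<comment> \<open>As det T = det b / det (a j), the number of coefficients turns into a volume
      and the dependence on the scale disappears.\<close>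
    have "norm \<mu> powr p / \<bar>det (a j)\<bar> = norm \<mu> powr p / \<bar>det b\<bar> * \<bar>det T\<bar>"
      using invertible_scale[OF j] by (simp add: T_def)
    then have "ennreal (norm \<mu> powr p / \<bar>det (a j)\<bar>) = ennreal (norm \<mu> powr p / \<bar>det b\<bar>) * ennreal \<bar>det T\<bar>"
      by (simp only:) (rule ennreal_mult; simp)
    then show ?thesis by (simp only: ac_simps)
  qed
  also have "\<dots> \<le> ennreal (norm \<mu> powr p / \<bar>det b\<bar>) * (emeasure lebesgue K + ennreal \<delta>)"
    by (intro mult_left_mono cardI) auto
  finally have M: "mass c \<le> ennreal (norm \<mu> powr p / \<bar>det b\<bar>) * (emeasure lebesgue K + ennreal \<delta>)" .
  have "adapted p a b \<Omega> \<psi> c"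
    unfolding adapted_def
  proof (intro allI impI subsetI)
    fix i k x assume "0 < i" "c i k \<noteq> 0" and x: "x \<in> ess_support (affine i k)"
    then have [simp]: "i = j" and k: "k \<in> I" by (auto simp: c_def split: if_splits)
    obtain y where y: "x = T *v y" "norm (y - lattice_point k) \<le> R"
      using ess_support_affine[OF j, of x k] x by (auto simp: T_def)
    obtain y' where y': "k = lattice_floor y'" "T *v y' \<in> K" using k by (auto simp: I_def)
    have "norm (y - y') \<le> norm (y - lattice_point k) + norm (y' - lattice_point k)"
      using norm_triangle_ineq4[of "y - lattice_point k" "y' - lattice_point k"] by simp
    then have "norm (y - y') \<le> R + 3 * d"
      using y(2) norm_minus_lattice_floor[of y'] y'(1) d by (simp add: d_def)
    then show "x \<in> \<Omega>" using near[OF y'(2)] V(3) y(1) by auto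
  qed
  moreover have "finite {(i, k). c i k \<noteq> 0}"
    by (rule finite_subset[of _ "{j} \<times> I"]) (use finI in \<open>auto simp: c_def split: if_splits\<close>)
  ultimately have "admissible \<Omega> c" using j by (simp add: admissible_def c_def)
  then show ?thesis using F M by (rule that)
qed

end

section \<open>Approximation by finite synthesis\<close>

context affine_system
begin

lemma measurable_S:
  assumes "admissible \<Omega> c"
  shows "S c \<in> borel_measurable lebesgue"
proof -
  let ?F = "{(j, k). c j k \<noteq> 0}"
  have F: "finite ?F" "?F \<subseteq> {0<..} \<times> UNIV"
    using assms gr0I by (fastforce simp: admissible_def)+
  have "S c = (\<lambda>x. \<Sum>i\<in>?F. c (fst i) (snd i) * affine (fst i) (snd i) x)"
    by (rule ext, subst synthesis_finite_sum[OF F]) (auto simp: split_beta')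
  moreover have "affine (fst i) (snd i) \<in> borel_measurable lebesgue" if "i \<in> ?F" for i
    using that F(2) by (intro measurable_affine) auto
  ultimately show ?thesis by simp
qed

lemma S_add:
  assumes "admissible \<Omega> c" "admissible \<Omega>' c'"
  shows "S (\<lambda>j k. c j k + c' j k) x = S c x + S c' x"
proof -
  let ?F = "{(j, k). c j k \<noteq> 0} \<union> {(j, k). c' j k \<noteq> 0}"
  have F: "finite ?F" "?F \<subseteq> {0<..} \<times> UNIV"
    using assms gr0I by (fastforce simp: admissible_def)+
  show ?thesis
    by (subst (1 2 3) synthesis_finite_sum[OF F])
      (auto simp: split_beta' sum.distrib[symmetric] distrib_right)
qed

lemma S_cmult: "S (\<lambda>j k. v * c j k) x = v * S c x"
proof -
  have "v * S c x = (\<Sum>\<^sub>\<infinity>i\<in>{0<..} \<times> UNIV. v * (case i of (j, k) \<Rightarrow> c j k * affine j k x))"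
    unfolding synthesis_def by (rule infsum_cmult_right'[symmetric])
  then show ?thesis unfolding synthesis_def by (simp add: split_beta' mult.assoc)
qed

lemma admissible_0: "admissible \<Omega> (\<lambda>j k. 0)"
  by (simp add: admissible_def adapted_def)

lemma admissible_add:
  assumes "admissible \<Omega> c" "admissible \<Omega> c'"
  shows "admissible \<Omega> (\<lambda>j k. c j k + c' j k)"
proof -
  have "finite {(j, k). c j k + c' j k \<noteq> 0}"
    by (rule finite_subset[of _ "{(j, k). c j k \<noteq> 0} \<union> {(j, k). c' j k \<noteq> 0}"])
      (use assms in \<open>auto simp: admissible_def\<close>)
  moreover have "c j k \<noteq> 0 \<or> c' j k \<noteq> 0" if "c j k + c' j k \<noteq> 0" for j k
    using that by auto
  ultimately show ?thesis using assms unfolding admissible_def adapted_def by (metis add_0)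
qed

lemma admissible_cmult:
  assumes "admissible \<Omega> c"
  shows "admissible \<Omega> (\<lambda>j k. v * c j k)"
proof -
  have "finite {(j, k). v * c j k \<noteq> 0}"
    by (rule finite_subset[of _ "{(j, k). c j k \<noteq> 0}"]) (use assms in \<open>auto simp: admissible_def\<close>)
  then show ?thesis using assms by (auto simp: admissible_def adapted_def)
qed

text \<open>\<theta> is the relative error and \<open>C\<close> the cost in coefficients. The
  additive \<epsilon> absorbs the losses of sums and limits, so that both constants survive the
  closure properties unchanged.\<close>

definition approximable :: "ennreal \<Rightarrow> ennreal \<Rightarrow> (real ^ 'd) set \<Rightarrow> (real ^ 'd \<Rightarrow> complex) \<Rightarrow> bool" where
  "approximable \<theta> C \<Omega> f \<longleftrightarrow> f \<in> borel_measurable lebesgue \<and>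
    (\<forall>\<epsilon>>0. \<exists>c. admissible \<Omega> c \<and> Lp_mass p (\<lambda>x. f x - S c x) \<le> \<theta> * Lp_mass p f + ennreal \<epsilon> \<and>
      mass c \<le> C * Lp_mass p f + ennreal \<epsilon>)"

lemma approximableE:
  assumes "approximable \<theta> C \<Omega> f" "0 < \<epsilon>"
  obtains c where "admissible \<Omega> c" "Lp_mass p (\<lambda>x. f x - S c x) \<le> \<theta> * Lp_mass p f + ennreal \<epsilon>"
    "mass c \<le> C * Lp_mass p f + ennreal \<epsilon>"
  using assms unfolding approximable_def by blast

lemma approximable_0: "approximable \<theta> C \<Omega> (\<lambda>x. 0)"
proof -
  have "S (\<lambda>j k. 0) x = 0" for x by (subst synthesis_finite_sum[of "{}"]) auto
  then show ?thesis unfolding approximable_def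
    by (auto intro!: exI[of _ "\<lambda>j k. 0"] simp: admissible_0 Lp_mass_def lp_mass_def split_beta')
qed

lemma approximable_cmult:
  assumes "approximable \<theta> C \<Omega> f"
  shows "approximable \<theta> C \<Omega> (\<lambda>x. v * f x)"
proof (cases "v = 0")
  case True
  then show ?thesis using approximable_0 by simp
next
  case False
  have f [measurable]: "f \<in> borel_measurable lebesgue" using assms by (simp add: approximable_def)
  have "\<exists>c. admissible \<Omega> c \<and> Lp_mass p (\<lambda>x. v * f x - S c x) \<le> \<theta> * Lp_mass p (\<lambda>x. v * f x) + ennreal \<epsilon> \<and>
      mass c \<le> C * Lp_mass p (\<lambda>x. v * f x) + ennreal \<epsilon>" if \<epsilon>: "0 < \<epsilon>" for \<epsilon>
  proof -
    define w where "w = norm v powr p"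
    have w: "0 < w" using False by (simp add: w_def)
    have e: "ennreal w * ennreal (\<epsilon> / w) = ennreal \<epsilon>"
      using w that by (simp add: ennreal_mult[symmetric])
    obtain c where c: "admissible \<Omega> c" "Lp_mass p (\<lambda>x. f x - S c x) \<le> \<theta> * Lp_mass p f + ennreal (\<epsilon> / w)"
        "mass c \<le> C * Lp_mass p f + ennreal (\<epsilon> / w)"
      using approximableE[OF assms divide_pos_pos[OF \<epsilon> w]] .
    note [measurable] = measurable_S[OF c(1)]
    have "Lp_mass p (\<lambda>x. v * f x - S (\<lambda>j k. v * c j k) x) = Lp_mass p (\<lambda>x. v * (f x - S c x))"
      by (simp add: S_cmult right_diff_distrib)
    also have "\<dots> = ennreal w * Lp_mass p (\<lambda>x. f x - S c x)"
      unfolding w_def by (rule Lp_mass_cmult) measurable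
    also have "\<dots> \<le> ennreal w * (\<theta> * Lp_mass p f + ennreal (\<epsilon> / w))"
      by (intro mult_left_mono c) auto
    also have "\<dots> = \<theta> * Lp_mass p (\<lambda>x. v * f x) + ennreal \<epsilon>"
      by (simp add: Lp_mass_cmult[OF f] w_def[symmetric] distrib_left e mult.left_commute)
    finally have 1: "Lp_mass p (\<lambda>x. v * f x - S (\<lambda>j k. v * c j k) x) \<le> \<theta> * Lp_mass p (\<lambda>x. v * f x) + ennreal \<epsilon>" .
    have "mass (\<lambda>j k. v * c j k) = ennreal w * mass c"
      using lp_mass_cmult[of p _ v "case_prod c"] by (simp add: w_def split_beta')
    also have "\<dots> \<le> ennreal w * (C * Lp_mass p f + ennreal (\<epsilon> / w))"
      by (intro mult_left_mono c) auto
    also have "\<dots> = C * Lp_mass p (\<lambda>x. v * f x) + ennreal \<epsilon>"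
      by (simp add: Lp_mass_cmult[OF f] w_def[symmetric] distrib_left e mult.left_commute)
    finally show ?thesis using 1 admissible_cmult[OF c(1)] by blast
  qed
  then show ?thesis by (simp add: approximable_def)
qed

lemma Lp_mass_add_disjoint:
  assumes "f \<in> borel_measurable lebesgue" "g \<in> borel_measurable lebesgue" "\<And>x. f x = 0 \<or> g x = 0"
  shows "Lp_mass p (\<lambda>x. f x + g x) = Lp_mass p f + Lp_mass p g"
proof -
  note [measurable] = assms(1,2)
  have "Lp_mass p (\<lambda>x. f x + g x) = (\<integral>\<^sup>+x. ennreal (norm (f x) powr p) + ennreal (norm (g x) powr p) \<partial>lebesgue)"
    unfolding Lp_mass_def
  proof (rule nn_integral_cong)
    show "ennreal (norm (f x + g x) powr p) = ennreal (norm (f x) powr p) + ennreal (norm (g x) powr p)" for x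
      using assms(3)[of x] p by auto
  qed
  then show ?thesis by (simp add: Lp_mass_def nn_integral_add)
qed

text \<open>Disjointness serves the right-hand sides, where the masses of f and g must add up
  exactly; the approximants may overlap, since subadditivity suffices for errors and
  coefficients.\<close>

lemma approximable_add:
  assumes "approximable \<theta> C \<Omega> f" "approximable \<theta> C \<Omega> g" "\<And>x. f x = 0 \<or> g x = 0"
  shows "approximable \<theta> C \<Omega> (\<lambda>x. f x + g x)"
proof -
  have [measurable]: "f \<in> borel_measurable lebesgue" "g \<in> borel_measurable lebesgue"
    using assms by (simp_all add: approximable_def)
  note N = Lp_mass_add_disjoint[OF this assms(3)]
  have "\<exists>c. admissible \<Omega> c \<and> Lp_mass p (\<lambda>x. f x + g x - S c x) \<le> \<theta> * Lp_mass p (\<lambda>x. f x + g x) + ennreal \<epsilon> \<and>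
      mass c \<le> C * Lp_mass p (\<lambda>x. f x + g x) + ennreal \<epsilon>" if \<epsilon>: "0 < \<epsilon>" for \<epsilon>
  proof -
    have e: "ennreal (\<epsilon> / 2) + ennreal (\<epsilon> / 2) = ennreal \<epsilon>" using \<epsilon> by (simp flip: ennreal_plus)
    obtain c where c: "admissible \<Omega> c" "Lp_mass p (\<lambda>x. f x - S c x) \<le> \<theta> * Lp_mass p f + ennreal (\<epsilon> / 2)"
        "mass c \<le> C * Lp_mass p f + ennreal (\<epsilon> / 2)"
      using approximableE[OF assms(1) half_gt_zero[OF \<epsilon>]] .
    obtain c' where c': "admissible \<Omega> c'" "Lp_mass p (\<lambda>x. g x - S c' x) \<le> \<theta> * Lp_mass p g + ennreal (\<epsilon> / 2)"
        "mass c' \<le> C * Lp_mass p g + ennreal (\<epsilon> / 2)"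
      using approximableE[OF assms(2) half_gt_zero[OF \<epsilon>]] .
    let ?c = "\<lambda>j k. c j k + c' j k"
    note [measurable] = measurable_S[OF c(1)] measurable_S[OF c'(1)]
    have "Lp_mass p (\<lambda>x. f x + g x - S ?c x) = Lp_mass p (\<lambda>x. (f x - S c x) + (g x - S c' x))"
      by (simp only: S_add[OF c(1) c'(1)] add_diff_add)
    also have "\<dots> \<le> Lp_mass p (\<lambda>x. f x - S c x) + Lp_mass p (\<lambda>x. g x - S c' x)"
      by (intro Lp_mass_add p) measurable
    also have "\<dots> \<le> (\<theta> * Lp_mass p f + ennreal (\<epsilon> / 2)) + (\<theta> * Lp_mass p g + ennreal (\<epsilon> / 2))"
      by (intro add_mono c c')
    also have "\<dots> = \<theta> * Lp_mass p (\<lambda>x. f x + g x) + ennreal \<epsilon>"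
      unfolding N e[symmetric] by (simp only: distrib_left ac_simps)
    finally have 1: "Lp_mass p (\<lambda>x. f x + g x - S ?c x) \<le> \<theta> * Lp_mass p (\<lambda>x. f x + g x) + ennreal \<epsilon>" .
    have "mass ?c \<le> mass c + mass c'"
      using lp_mass_add[OF p, of _ "case_prod c" "case_prod c'"] by (simp add: split_beta')
    also have "\<dots> \<le> (C * Lp_mass p f + ennreal (\<epsilon> / 2)) + (C * Lp_mass p g + ennreal (\<epsilon> / 2))"
      by (intro add_mono c c')
    also have "\<dots> = C * Lp_mass p (\<lambda>x. f x + g x) + ennreal \<epsilon>"
      unfolding N e[symmetric] by (simp only: distrib_left ac_simps)
    finally show ?thesis using 1 admissible_add[OF c(1) c'(1)] by blast
  qed
  then show ?thesis by (simp add: approximable_def)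
qed

lemma approximable_limit:
  fixes t C :: real
  assumes f [measurable]: "f \<in> borel_measurable lebesgue"
    and t: "0 \<le> t" "0 \<le> C"
    and lim: "\<And>\<eta>. 0 < \<eta> \<Longrightarrow> \<exists>g. approximable (ennreal t) (ennreal C) \<Omega> g \<and> Lp_mass p (\<lambda>x. f x - g x) \<le> ennreal \<eta>"
  shows "approximable (ennreal t) (ennreal C) \<Omega> f"
proof -
  have "\<exists>c. admissible \<Omega> c \<and> Lp_mass p (\<lambda>x. f x - S c x) \<le> ennreal t * Lp_mass p f + ennreal \<epsilon> \<and>
      mass c \<le> ennreal C * Lp_mass p f + ennreal \<epsilon>" if \<epsilon>: "0 < \<epsilon>" for \<epsilon>
  proof -
    \<comment> \<open>The losses are \<open>(2 + t) * \<eta>\<close> in the error and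
      \<open>(C + 1) * \<eta>\<close> in the coefficients; this denominator covers both.\<close>
    define \<eta> where "\<eta> = \<epsilon> / (2 + t + C)"
    have \<eta>: "0 < \<eta>" using t \<epsilon> by (simp add: \<eta>_def add_nonneg_pos)
    have "\<eta> * (2 + t + C) = \<epsilon>" using t by (simp add: \<eta>_def)
    moreover have "0 \<le> \<eta> * t" "0 \<le> \<eta> * C" using t \<eta> by auto
    ultimately have eta: "\<eta> + (t * \<eta> + \<eta>) \<le> \<epsilon>" "C * \<eta> + \<eta> \<le> \<epsilon>"
      using \<eta> by (auto simp: algebra_simps)
    obtain g where g: "approximable (ennreal t) (ennreal C) \<Omega> g" "Lp_mass p (\<lambda>x. f x - g x) \<le> ennreal \<eta>"
      using lim[OF \<eta>] by blast
    have [measurable]: "g \<in> borel_measurable lebesgue" using g(1) by (simp add: approximable_def)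
    obtain c where c: "admissible \<Omega> c" "Lp_mass p (\<lambda>x. g x - S c x) \<le> ennreal t * Lp_mass p g + ennreal \<eta>"
        "mass c \<le> ennreal C * Lp_mass p g + ennreal \<eta>"
      using approximableE[OF g(1) \<eta>] .
    note [measurable] = measurable_S[OF c(1)]
    have "Lp_mass p g = Lp_mass p (\<lambda>x. f x + (- 1) * (f x - g x))" by simp
    also have "\<dots> \<le> Lp_mass p f + Lp_mass p (\<lambda>x. (- 1) * (f x - g x))"
      by (intro Lp_mass_add p) measurable
    also have "Lp_mass p (\<lambda>x. (- 1) * (f x - g x)) = Lp_mass p (\<lambda>x. f x - g x)"
      by (subst Lp_mass_cmult) auto
    finally have gf: "Lp_mass p g \<le> Lp_mass p f + ennreal \<eta>" using g(2) by (meson add_left_mono order_trans)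
    have "Lp_mass p (\<lambda>x. f x - S c x) = Lp_mass p (\<lambda>x. (f x - g x) + (g x - S c x))" by simp
    also have "\<dots> \<le> Lp_mass p (\<lambda>x. f x - g x) + Lp_mass p (\<lambda>x. g x - S c x)"
      by (intro Lp_mass_add p) measurable
    also have "\<dots> \<le> ennreal \<eta> + (ennreal t * (Lp_mass p f + ennreal \<eta>) + ennreal \<eta>)"
      using c(2) gf by (intro add_mono g(2)) (meson add_right_mono mult_left_mono order_trans zero_le)
    also have "\<dots> = ennreal t * Lp_mass p f + ennreal (\<eta> + (t * \<eta> + \<eta>))"
    proof -
      have "ennreal (\<eta> + (t * \<eta> + \<eta>)) = ennreal \<eta> + (ennreal t * ennreal \<eta> + ennreal \<eta>)"
        using t \<eta> by (simp only: ennreal_plus ennreal_mult add_nonneg_nonneg mult_nonneg_nonneg less_imp_le)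
      then show ?thesis by (simp only: distrib_left ac_simps)
    qed
    also have "\<dots> \<le> ennreal t * Lp_mass p f + ennreal \<epsilon>" by (intro add_left_mono ennreal_leI eta)
    finally have 1: "Lp_mass p (\<lambda>x. f x - S c x) \<le> ennreal t * Lp_mass p f + ennreal \<epsilon>" .
    have "mass c \<le> ennreal C * (Lp_mass p f + ennreal \<eta>) + ennreal \<eta>"
      using c(3) gf by (meson add_right_mono mult_left_mono order_trans zero_le)
    also have "\<dots> = ennreal C * Lp_mass p f + ennreal (C * \<eta> + \<eta>)"
      using t \<eta> by (simp add: distrib_left ennreal_mult ac_simps)
    also have "\<dots> \<le> ennreal C * Lp_mass p f + ennreal \<epsilon>" by (intro add_left_mono ennreal_leI eta)
    finally show ?thesis using 1 c(1) by blast
  qed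
  then show ?thesis by (simp add: approximable_def)
qed

lemma approximable_indicator_compact:
  assumes K: "compact K" "K \<subseteq> \<Omega>" and \<Omega>: "open \<Omega>"
    and dev: "(\<integral>\<^sup>+x. cube_deviation p \<mu> \<phi> x \<partial>lebesgue) = ennreal t" "0 \<le> t"
    and C: "C = norm \<mu> powr p / \<bar>det b\<bar>"
  shows "approximable (ennreal t) (ennreal C) \<Omega> (indicator K)"
proof -
  have Kl: "K \<in> sets lebesgue" using K(1) by (simp add: lmeasurable_compact fmeasurableD)
  note mK = Lp_mass_indicator[OF p(1) Kl]
  obtain n where n: "Lp_mass p \<phi> = ennreal n" "0 \<le> n"
    using \<phi>_mass by (cases "Lp_mass p \<phi>") auto
  define m where "m = norm \<mu> powr p"
  have m: "0 \<le> m" by (simp add: m_def)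
  have C0: "0 \<le> C" by (simp add: C)
  have "\<exists>c. admissible \<Omega> c \<and> Lp_mass p (\<lambda>x. indicator K x - S c x) \<le> ennreal t * Lp_mass p (indicator K) + ennreal \<epsilon> \<and>
      mass c \<le> ennreal C * Lp_mass p (indicator K) + ennreal \<epsilon>" if \<epsilon>: "0 < \<epsilon>" for \<epsilon>
  proof -
    \<comment> \<open>Collects the factors of \<delta> in the error and coefficient bounds of
      \<open>indicator_approximable\<close>.\<close>
    define A where "A = 1 + t + 2 * m * n + C"
    have mn: "0 \<le> m * n" using m n by simp
    have A: "0 < A" using dev(2) mn C0 unfolding A_def by linarith
    define \<delta> where "\<delta> = \<epsilon> / A"
    have \<delta>: "0 < \<delta>" using A \<epsilon> by (simp add: \<delta>_def)
    have "\<delta> * A = \<epsilon>" using A by (simp add: \<delta>_def)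
    moreover have "0 \<le> \<delta> * t" "0 \<le> \<delta> * C" "0 \<le> \<delta> * (m * n)" using dev(2) C0 mn \<delta> by auto
    ultimately have del: "\<delta> + t * \<delta> + m * (2 * \<delta> * n) \<le> \<epsilon>" "C * \<delta> \<le> \<epsilon>"
      using \<delta> unfolding A_def by (auto simp: algebra_simps)
    obtain c where c: "admissible \<Omega> c"
      "Lp_mass p (\<lambda>x. indicator K x - S c x) \<le>
        ennreal \<delta> + (ennreal t * (emeasure lebesgue K + ennreal \<delta>) + ennreal m * (2 * ennreal \<delta> * Lp_mass p \<phi>))"
      "mass c \<le> ennreal C * (emeasure lebesgue K + ennreal \<delta>)"
      unfolding C m_def by (rule indicator_approximable[OF K \<Omega> dev(1) \<delta>])
    note c(2)
    also have "2 * ennreal \<delta> = ennreal (2 * \<delta>)" using \<delta> by (simp add: ennreal_mult)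
    also have "ennreal \<delta> + (ennreal t * (emeasure lebesgue K + ennreal \<delta>) + ennreal m * (ennreal (2 * \<delta>) * Lp_mass p \<phi>))
        = ennreal t * emeasure lebesgue K + (ennreal \<delta> + ennreal (t * \<delta>) + ennreal (m * (2 * \<delta> * n)))"
      using dev(2) m n \<delta> by (simp add: n(1) distrib_left ennreal_mult ac_simps)
    also have "ennreal \<delta> + ennreal (t * \<delta>) + ennreal (m * (2 * \<delta> * n)) = ennreal (\<delta> + t * \<delta> + m * (2 * \<delta> * n))"
      using dev(2) m n \<delta> by (simp add: ennreal_plus)
    also have "ennreal t * emeasure lebesgue K + \<dots> \<le> ennreal t * emeasure lebesgue K + ennreal \<epsilon>"
      by (intro add_left_mono ennreal_leI del)
    finally have 1: "Lp_mass p (\<lambda>x. indicator K x - S c x) \<le> ennreal t * emeasure lebesgue K + ennreal \<epsilon>" .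
    note c(3)
    also have "ennreal C * (emeasure lebesgue K + ennreal \<delta>) = ennreal C * emeasure lebesgue K + ennreal (C * \<delta>)"
      using C0 \<delta> by (simp add: distrib_left ennreal_mult)
    also have "\<dots> \<le> ennreal C * emeasure lebesgue K + ennreal \<epsilon>" by (intro add_left_mono ennreal_leI del)
    finally show ?thesis using 1 c(1) unfolding mK by blast
  qed
  then show ?thesis using Kl by (simp add: approximable_def)
qed

end

text \<open>Up to a null set \<open>A\<close> is a countable union of compact sets. Their finite
  unions increase, and continuity from above applies because \<open>A\<close> has finite
  measure.\<close>

lemma inner_compact:
  fixes A :: "'a::euclidean_space set"
  assumes "A \<in> lmeasurable" "0 < \<eta>"
  obtains K where "compact K" "K \<subseteq> A" "emeasure lebesgue (A - K) \<le> ennreal \<eta>"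
proof -
  obtain N D where N: "negligible N" "\<And>n::nat. compact (D n)" "A = (\<Union>n. D n) \<union> N"
    using lebesgue_regular_inner[of A] assms(1) by (metis fmeasurableD)
  define K where "K n = (\<Union>i\<le>n. D i)" for n
  have K: "compact (K n)" "K n \<subseteq> A" for n using N by (auto simp: K_def)
  have Kl: "K n \<in> sets lebesgue" for n using K(1) by (simp add: lmeasurable_compact fmeasurableD)
  have "(\<lambda>n. emeasure lebesgue (A - K n)) \<longlonglongrightarrow> emeasure lebesgue (\<Inter>n. A - K n)"
  proof (rule Lim_emeasure_decseq)
    show "range (\<lambda>n. A - K n) \<subseteq> sets lebesgue" using Kl assms(1) by (auto simp: fmeasurableD)
    show "decseq (\<lambda>n. A - K n)" by (auto simp: decseq_def K_def)
    show "emeasure lebesgue (A - K n) \<noteq> \<infinity>" for n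
      using emeasure_mono[of "A - K n" A lebesgue] assms(1) by (auto simp: fmeasurable_def top_unique)
  qed
  moreover have "(\<Inter>n. A - K n) \<subseteq> N" using N(3) by (auto simp: K_def)
  then have "emeasure lebesgue (\<Inter>n. A - K n) = 0"
    using N(1) negligible_subset negligible_iff_emeasure0 by (metis negligible_iff_null_sets null_setsD1)
  ultimately have "(\<lambda>n. emeasure lebesgue (A - K n)) \<longlonglongrightarrow> 0" by simp
  then have "eventually (\<lambda>n. emeasure lebesgue (A - K n) < ennreal \<eta>) sequentially"
    using assms(2) by (intro order_tendstoD) auto
  then obtain n where "emeasure lebesgue (A - K n) < ennreal \<eta>" by (auto dest: eventually_happens)
  then show ?thesis using K by (intro that[of "K n"]) auto
qed

text \<open>\<open>t\<close> is the p-th power of the deviation quasi-norm in the hypothesis of the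
  theorem, and \<open>C\<close> the coefficient mass per unit volume of cells.\<close>

locale affine_system_deviation = affine_system p a b \<psi> R
  for p :: real and a b and \<psi> :: "real ^ 'd \<Rightarrow> complex" and R +
  fixes \<mu> :: complex and t C :: real and \<Omega> :: "(real ^ 'd) set"
  assumes dev: "(\<integral>\<^sup>+x. cube_deviation p \<mu> \<phi> x \<partial>lebesgue) = ennreal t"
    and t: "0 \<le> t" "t < 1"
    and C: "C = norm \<mu> powr p / \<bar>det b\<bar>"
    and \<Omega>: "open \<Omega>"
begin

abbreviation approx where "approx \<equiv> approximable (ennreal t) (ennreal C) \<Omega>"

section \<open>Approximation of arbitrary functions vanishing off \<Omega>\<close>

lemma C_nonneg: "0 \<le> C" by (simp add: C)

lemma approximable_indicator:
  assumes A: "A \<in> lmeasurable" "A \<subseteq> \<Omega>"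
  shows "approx (indicator A)"
proof (rule approximable_limit)
  have Al: "A \<in> sets lebesgue" using A(1) by (rule fmeasurableD)
  then show "indicator A \<in> borel_measurable lebesgue" by simp
  fix \<eta> :: real assume "0 < \<eta>"
  then obtain K where K: "compact K" "K \<subseteq> A" "emeasure lebesgue (A - K) \<le> ennreal \<eta>"
    using inner_compact[OF A(1)] by metis
  have Kl: "K \<in> sets lebesgue" using K(1) by (simp add: lmeasurable_compact fmeasurableD)
  have "(\<lambda>x. indicator A x - indicator K x :: complex) = indicator (A - K)"
    using K(2) by (auto simp: indicator_def fun_eq_iff)
  then have "Lp_mass p (\<lambda>x. indicator A x - indicator K x) \<le> ennreal \<eta>"
    using Lp_mass_indicator[OF p(1), of "A - K"] K(3) Al Kl by simp
  moreover have "approx (indicator K)"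
    using K A(2) by (intro approximable_indicator_compact[OF _ _ \<Omega> dev t(1) C]) auto
  ultimately show "\<exists>g. approx g \<and> Lp_mass p (\<lambda>x. indicator A x - g x) \<le> ennreal \<eta>" by blast
qed (use t C_nonneg in auto)

lemma approximable_simple_function:
  assumes s: "simple_function lebesgue s" "Lp_mass p s < \<infinity>" "\<And>x. x \<notin> \<Omega> \<Longrightarrow> s x = 0"
  shows "approx s"
proof -
  have fin: "finite (range s)" using s(1) by (simp add: simple_function_def)
  have lvl: "s -` {v} \<in> sets lebesgue" for v
    using simple_functionD(2)[OF s(1), of "{v}"] by simp
  have sm [measurable]: "s \<in> borel_measurable lebesgue"
    using borel_measurable_simple_function[OF s(1)] .
  \<comment> \<open>Chebyshev: a finite mass forces finite measure on the level sets of nonzero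
    values.\<close>
  have lm: "s -` {v} \<in> lmeasurable" if v: "v \<noteq> 0" for v
  proof -
    have "ennreal (norm v powr p) * emeasure lebesgue (s -` {v}) = (\<integral>\<^sup>+x. ennreal (norm v powr p) * indicator (s -` {v}) x \<partial>lebesgue)"
      using lvl by (simp add: nn_integral_cmult)
    also have "\<dots> \<le> Lp_mass p s"
      unfolding Lp_mass_def by (intro nn_integral_mono) (auto simp: indicator_def)
    finally have "ennreal (norm v powr p) * emeasure lebesgue (s -` {v}) < \<infinity>" using s(2) by simp
    then show ?thesis using lvl v by (auto simp: fmeasurable_def ennreal_mult_less_top)
  qed
  have "approx (\<lambda>x. \<Sum>v\<in>V. v * indicator (s -` {v}) x)" if "finite V" "V \<subseteq> range s - {0}" for V
    using that
  proof (induction V)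
    case empty
    then show ?case using approximable_0 by simp
  next
    case (insert v V)
    have "s -` {v} \<subseteq> \<Omega>" using insert s(3) by auto
    then have "approx (\<lambda>x. v * indicator (s -` {v}) x)"
      using insert lm by (intro approximable_cmult approximable_indicator) auto
    moreover have "v * indicator (s -` {v}) x = 0 \<or> (\<Sum>w\<in>V. w * indicator (s -` {w}) x) = 0" for x
      using insert(2) by (cases "s x = v") (auto simp: indicator_def intro!: sum.neutral)
    ultimately have "approx (\<lambda>x. v * indicator (s -` {v}) x + (\<Sum>w\<in>V. w * indicator (s -` {w}) x))"
      using insert by (intro approximable_add) auto
    then show ?case by (simp only: sum.insert[OF insert(1,2)])
  qed
  from this[of "range s - {0}"] have "approx (\<lambda>x. \<Sum>v\<in>range s - {0}. v * indicator (s -` {v}) x)"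
    using fin by simp
  moreover have "(\<Sum>v\<in>range s - {0}. v * indicator (s -` {v}) x) = s x" for x
  proof (cases "s x = 0")
    case True
    then show ?thesis by (auto simp: indicator_def intro!: sum.neutral)
  next
    case False
    then have "(\<Sum>v\<in>range s - {0}. v * indicator (s -` {v}) x) = s x * indicator (s -` {s x}) x"
      using fin by (subst sum.remove[of _ "s x"]) (auto simp: indicator_def intro!: sum.neutral)
    then show ?thesis by simp
  qed
  ultimately show ?thesis by simp
qed

lemma approximable_all:
  assumes f [measurable]: "f \<in> borel_measurable lebesgue" and fin: "Lp_mass p f < \<infinity>"
    and zero: "\<And>x. x \<notin> \<Omega> \<Longrightarrow> f x = 0"
  shows "approx f"
proof (rule approximable_limit[OF f t(1) C_nonneg])
  fix \<eta> :: real assume \<eta>: "0 < \<eta>"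
  \<comment> \<open>The bound by \<open>2 * norm (f x)\<close> makes each \<open>F i\<close> vanish
    where f does, in particular off \<Omega>, and supplies the dominating function.\<close>
  obtain F where F: "\<And>i. simple_function lebesgue (F i)" "\<And>x. (\<lambda>i. F i x) \<longlonglongrightarrow> f x"
    "\<And>i x. norm (F i x) \<le> 2 * norm (f x)"
    using borel_measurable_implies_sequence_metric[OF f, of 0] by auto
  have [measurable]: "F i \<in> borel_measurable lebesgue" for i
    using borel_measurable_simple_function[OF F(1)] .
  have bound: "norm (f x - F i x) powr p \<le> 3 powr p * norm (f x) powr p"
    "norm (F i x) powr p \<le> 3 powr p * norm (f x) powr p" for i x
  proof -
    have "norm (f x - F i x) \<le> 3 * norm (f x)" "norm (F i x) \<le> 3 * norm (f x)"
      using norm_triangle_ineq4[of "f x" "F i x"] F(3)[of i x] norm_ge_zero[of "f x"] by linarith+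
    then have "norm (f x - F i x) powr p \<le> (3 * norm (f x)) powr p" "norm (F i x) powr p \<le> (3 * norm (f x)) powr p"
      using p by (auto intro!: powr_mono2)
    then show "norm (f x - F i x) powr p \<le> 3 powr p * norm (f x) powr p"
      "norm (F i x) powr p \<le> 3 powr p * norm (f x) powr p" by (simp_all add: powr_mult)
  qed
  have w: "(\<integral>\<^sup>+x. ennreal (3 powr p * norm (f x) powr p) \<partial>lebesgue) < \<infinity>"
    using fin by (simp add: ennreal_mult nn_integral_cmult Lp_mass_def ennreal_mult_less_top)
  have "(\<lambda>i. \<integral>\<^sup>+x. ennreal (norm (f x - F i x) powr p) \<partial>lebesgue) \<longlonglongrightarrow> (\<integral>\<^sup>+(x :: real ^ 'd). 0 \<partial>lebesgue)"
  proof (rule nn_integral_dominated_convergence[OF _ _ _ _ w])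
    show "AE x in lebesgue. (\<lambda>i. ennreal (norm (f x - F i x) powr p)) \<longlonglongrightarrow> 0"
    proof (rule AE_I2)
      fix x
      have "(\<lambda>i. norm (f x - F i x)) \<longlonglongrightarrow> norm (f x - f x)"
        by (intro tendsto_intros F)
      then have "(\<lambda>i. norm (f x - F i x) powr p) \<longlonglongrightarrow> 0 powr p"
        using p by (intro tendsto_powr' tendsto_const) auto
      then show "(\<lambda>i. ennreal (norm (f x - F i x) powr p)) \<longlonglongrightarrow> 0"
        using tendsto_ennrealI by fastforce
    qed
  qed (use bound in \<open>auto intro!: ennreal_leI\<close>)
  then have "(\<lambda>i. Lp_mass p (\<lambda>x. f x - F i x)) \<longlonglongrightarrow> 0" by (simp add: Lp_mass_def)
  then have "eventually (\<lambda>i. Lp_mass p (\<lambda>x. f x - F i x) < ennreal \<eta>) sequentially"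
    using \<eta> by (intro order_tendstoD) auto
  then obtain i where i: "Lp_mass p (\<lambda>x. f x - F i x) < ennreal \<eta>" by (auto dest: eventually_happens)
  have "Lp_mass p (F i) \<le> (\<integral>\<^sup>+x. ennreal (3 powr p * norm (f x) powr p) \<partial>lebesgue)"
    unfolding Lp_mass_def by (intro nn_integral_mono ennreal_leI bound)
  then have "Lp_mass p (F i) < \<infinity>" using w by (rule order_le_less_trans)
  moreover have "F i x = 0" if "x \<notin> \<Omega>" for x using F(3)[of i x] zero[OF that] by simp
  ultimately have "approx (F i)" using F(1) by (intro approximable_simple_function) auto
  then show "\<exists>g. approx g \<and> Lp_mass p (\<lambda>x. f x - g x) \<le> ennreal \<eta>" using i by (auto intro: less_imp_le)
qed

text \<open>Makes the additive error relative by taking \<epsilon> as (1 - t) / 2 times the mass of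
  f; this raises t to (1 + t) / 2 and \<open>C\<close> by at most 1. Vanishing off \<Omega> is asked
  only almost everywhere, since the remainders of the iteration satisfy no more.\<close>

lemma approximation_step:
  assumes f: "f \<in> borel_measurable lebesgue" "Lp_mass p f < \<infinity>" "AE x in lebesgue. x \<notin> \<Omega> \<longrightarrow> f x = 0"
  obtains c where "admissible \<Omega> c" "Lp_mass p (\<lambda>x. f x - S c x) \<le> ennreal ((1 + t) / 2) * Lp_mass p f"
    "mass c \<le> ennreal (C + 1) * Lp_mass p f"
proof -
  obtain n where n: "Lp_mass p f = ennreal n" "0 \<le> n" using f(2) by (cases "Lp_mass p f") auto
  show ?thesis
  proof (cases "n = 0")
    \<comment> \<open>Zero mass would give \<epsilon> = 0, which is not allowed; the zero sequence
      serves instead.\<close>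
    case True
    have "S (\<lambda>j k. 0) x = 0" for x by (subst synthesis_finite_sum[of "{}"]) auto
    then show ?thesis using True n(1)
      by (intro that[of "\<lambda>j k. 0"] admissible_0) (auto simp: lp_mass_def split_beta')
  next
    case False
    define g where "g x = (if x \<in> \<Omega> then f x else 0)" for x
    have \<Omega>l [measurable]: "\<Omega> \<in> sets lebesgue" using \<Omega> by simp
    have fg: "AE x in lebesgue. f x = g x" using f(3) by eventually_elim (simp add: g_def)
    have g: "g \<in> borel_measurable lebesgue" unfolding g_def using f(1) by measurable
    have Ng: "Lp_mass p g = ennreal n" using Lp_mass_cong_AE[OF fg, of p] n by simp
    define \<epsilon> where "\<epsilon> = (1 - t) / 2 * n"
    have \<epsilon>: "0 < \<epsilon>" using False n t by (simp add: \<epsilon>_def)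
    have "\<epsilon> \<le> 1 * n" unfolding \<epsilon>_def using n t by (intro mult_right_mono) auto
    then have \<epsilon>': "C * n + \<epsilon> \<le> (C + 1) * n" by (simp add: algebra_simps)
    have \<epsilon>t: "t * n + \<epsilon> = (1 + t) / 2 * n" by (simp add: \<epsilon>_def field_simps)
    obtain c where c: "admissible \<Omega> c" "Lp_mass p (\<lambda>x. g x - S c x) \<le> ennreal t * Lp_mass p g + ennreal \<epsilon>"
      "mass c \<le> ennreal C * Lp_mass p g + ennreal \<epsilon>"
    proof (rule approximableE[OF _ \<epsilon>])
      show "approx g" using g Ng by (intro approximable_all) (auto simp: g_def)
    qed
    have "Lp_mass p (\<lambda>x. f x - S c x) = Lp_mass p (\<lambda>x. g x - S c x)"
      by (rule Lp_mass_cong_AE) (use fg in eventually_elim, simp)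
    also note c(2)
    also have "ennreal t * Lp_mass p g + ennreal \<epsilon> = ennreal (t * n + \<epsilon>)"
      unfolding Ng using t n \<epsilon> by (simp add: ennreal_mult ennreal_plus)
    also have "\<dots> = ennreal ((1 + t) / 2) * Lp_mass p f"
      unfolding \<epsilon>t n(1) using t n by (intro ennreal_mult) auto
    finally have 1: "Lp_mass p (\<lambda>x. f x - S c x) \<le> ennreal ((1 + t) / 2) * Lp_mass p f" .
    note c(3)
    also have "ennreal C * Lp_mass p g + ennreal \<epsilon> = ennreal (C * n + \<epsilon>)"
      unfolding Ng using C_nonneg n \<epsilon> by (simp add: ennreal_mult ennreal_plus)
    also have "\<dots> \<le> ennreal ((C + 1) * n)" using \<epsilon>' by (rule ennreal_leI)
    also have "\<dots> = ennreal (C + 1) * Lp_mass p f"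
      unfolding n(1) using C_nonneg n by (intro ennreal_mult) auto
    finally show ?thesis using c(1) 1 by (intro that)
  qed
qed

end

section \<open>Exact synthesis\<close>

lemma nn_integral_count_space_Times:
  assumes "countable A" "countable B"
  shows "(\<integral>\<^sup>+z. g z \<partial>count_space (A \<times> B)) = (\<integral>\<^sup>+x. \<integral>\<^sup>+y. g (x, y) \<partial>count_space B \<partial>count_space A)"
proof -
  interpret sigma_finite_measure "count_space B"
    using assms(2) by (rule sigma_finite_measure_count_space_countable)
  show ?thesis
    unfolding pair_measure_countable[OF assms, symmetric]
    by (rule nn_integral_fst[symmetric]) (simp add: pair_measure_countable[OF assms])
qed

lemma countable_scales: "countable ({0<..} \<times> (UNIV :: (int ^ 'd) set) :: (nat \<times> (int ^ 'd)) set)"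
  by simp

context affine_system
begin

text \<open>The p-th power of the normalising factor is |det (a j)|, which cancels the
  Jacobian.\<close>

lemma Lp_mass_affine:
  assumes j: "0 < j"
  shows "Lp_mass p (affine j k) = Lp_mass p \<psi>"
proof -
  define s where "s = \<bar>det (a j)\<bar> powr (1 / p)"
  define t where "t = matrix_inv (a j) *v (b *v lattice_point k)"
  have d: "det (a j) \<noteq> 0" using invertible_scale(3)[OF j] .
  have s0: "0 \<le> s" by (simp add: s_def)
  have s: "s powr p = \<bar>det (a j)\<bar>" using p by (simp add: s_def powr_powr)
  have m [measurable]: "(\<lambda>x. \<psi> (a j *v x)) \<in> borel_measurable lebesgue"
    using measurable_compose[OF measurable_matrix_vector_mult_lebesgue[OF a[OF j]] \<psi>_measurable] .
  note [measurable] = measurable_translate_lebesgue[OF m]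
  have "a j *v x - b *v lattice_point k = a j *v (x - t)" for x
    by (simp add: t_def matrix_vector_mult_diff_distrib matrix_inv_vector_mult[OF a[OF j]])
  then have "Lp_mass p (affine j k) = Lp_mass p (\<lambda>x. of_real s * \<psi> (a j *v (x - t)))"
    by (simp add: affine_function_def[abs_def] s_def)
  also have "\<dots> = ennreal \<bar>det (a j)\<bar> * Lp_mass p (\<lambda>x. \<psi> (a j *v (x - t)))"
    using s0 by (subst Lp_mass_cmult) (simp_all add: s)
  also have "Lp_mass p (\<lambda>x. \<psi> (a j *v (x - t))) = Lp_mass p (\<lambda>x. \<psi> (a j *v x))"
    unfolding Lp_mass_def by (rule nn_integral_minus_lebesgue[of "\<lambda>x. ennreal (norm (\<psi> (a j *v x)) powr p)"]) measurable
  also have "\<dots> = ennreal (1 / \<bar>det (a j)\<bar>) * Lp_mass p \<psi>"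
    by (rule Lp_mass_matrix_vector_mult[OF a[OF j] \<psi>_measurable])
  finally show ?thesis using d by (simp add: mult.assoc[symmetric] ennreal_mult[symmetric])
qed

text \<open>\<iota> reads the scale and the translation off a general index: it is the identity for
  one sequence and \<open>snd\<close> for a family over stages.\<close>

lemma nn_integral_atoms:
  assumes "countable I" "\<And>i. i \<in> I \<Longrightarrow> 0 < fst (\<iota> i)"
  shows "(\<integral>\<^sup>+x. lp_mass p I (\<lambda>i. e i * affine (fst (\<iota> i)) (snd (\<iota> i)) x) \<partial>lebesgue) = lp_mass p I e * Lp_mass p \<psi>"
    and "(\<lambda>x. lp_mass p I (\<lambda>i. e i * affine (fst (\<iota> i)) (snd (\<iota> i)) x)) \<in> borel_measurable lebesgue"
proof -
  have [measurable]: "affine (fst (\<iota> i)) (snd (\<iota> i)) \<in> borel_measurable lebesgue" if "i \<in> I" for i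
    using assms(2)[OF that] by (rule measurable_affine)
  show "(\<lambda>x. lp_mass p I (\<lambda>i. e i * affine (fst (\<iota> i)) (snd (\<iota> i)) x)) \<in> borel_measurable lebesgue"
    unfolding lp_mass_def by (rule borel_measurable_nn_integral_count_space[OF assms(1)]) measurable
  have "(\<integral>\<^sup>+x. lp_mass p I (\<lambda>i. e i * affine (fst (\<iota> i)) (snd (\<iota> i)) x) \<partial>lebesgue)
      = (\<integral>\<^sup>+i. Lp_mass p (\<lambda>x. e i * affine (fst (\<iota> i)) (snd (\<iota> i)) x) \<partial>count_space I)"
    unfolding lp_mass_def Lp_mass_def by (rule nn_integral_count_space_nn_integral[OF assms(1)]) measurable
  also have "\<dots> = (\<integral>\<^sup>+i. ennreal (norm (e i) powr p) * Lp_mass p \<psi> \<partial>count_space I)"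
  proof (rule nn_integral_cong)
    fix i assume "i \<in> space (count_space I)"
    then show "Lp_mass p (\<lambda>x. e i * affine (fst (\<iota> i)) (snd (\<iota> i)) x) = ennreal (norm (e i) powr p) * Lp_mass p \<psi>"
      using assms(2) by (subst Lp_mass_cmult) (auto simp: Lp_mass_affine)
  qed
  also have "\<dots> = lp_mass p I e * Lp_mass p \<psi>" by (simp add: nn_integral_multc lp_mass_def)
  finally show "(\<integral>\<^sup>+x. lp_mass p I (\<lambda>i. e i * affine (fst (\<iota> i)) (snd (\<iota> i)) x) \<partial>lebesgue) = lp_mass p I e * Lp_mass p \<psi>" .
qed

lemma Lp_mass_synthesis_le: "Lp_mass p (S c) \<le> mass c * Lp_mass p \<psi>"
proof -
  have "Lp_mass p (S c) \<le> (\<integral>\<^sup>+x. lp_mass p ({0<..} \<times> UNIV) (\<lambda>i. case_prod c i * affine (fst i) (snd i) x) \<partial>lebesgue)"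
    unfolding Lp_mass_def synthesis_def
    using norm_infsum_powr_le[OF p] by (intro nn_integral_mono) (simp add: split_beta')
  also have "\<dots> = mass c * Lp_mass p \<psi>"
    by (rule nn_integral_atoms(1)[OF countable_scales, of "\<lambda>i. i"]) auto
  finally show ?thesis .
qed

text \<open>Keeps the remainder \<open>f - S c\<close> zero off \<Omega>, so that the approximation
  step can be repeated on it.\<close>

lemma AE_synthesis_zero:
  assumes c: "admissible \<Omega> c"
  shows "AE x in lebesgue. x \<notin> \<Omega> \<longrightarrow> S c x = 0"
proof -
  let ?F = "{(j, k). c j k \<noteq> 0}"
  have F: "finite ?F" "?F \<subseteq> {0<..} \<times> UNIV"
    using c gr0I by (fastforce simp: admissible_def)+
  have "AE x in lebesgue. \<forall>j k. x \<notin> ess_support (affine j k) \<longrightarrow> affine j k x = 0"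
    by (simp add: AE_all_countable AE_not_in_ess_support)
  then show ?thesis
  proof eventually_elim
    case (elim x)
    show ?case
    proof
      assume x: "x \<notin> \<Omega>"
      have "affine j k x = 0" if jk: "(j, k) \<in> ?F" for j k
      proof -
        have "0 < j" "c j k \<noteq> 0" using jk F(2) by auto
        then have "ess_support (affine j k) \<subseteq> \<Omega>" using c by (simp add: admissible_def adapted_def)
        then show ?thesis using x elim by blast
      qed
      then show "S c x = 0"
        by (subst synthesis_finite_sum[OF F]) (auto intro!: sum.neutral)
    qed
  qed
qed

text \<open>
  The coefficients are summed over the stages \<open>n\<close>; the double family is absolutely summable at
  almost every point, which allows the stages to be resummed.
\<close>

lemma synthesis_of_stages:
  assumes adm: "\<And>n. admissible \<Omega> (c n)"
    and M: "(\<Sum>n. mass (c n)) < \<infinity>"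
  defines "d \<equiv> \<lambda>j k. \<Sum>\<^sub>\<infinity>n. c n j k"
  shows "mass d \<le> (\<Sum>n. mass (c n))"
    and "AE x in lebesgue. (\<lambda>n. S (c n) x) sums S d x"
    and "adapted p a b \<Omega> \<psi> d"
proof -
  let ?A = "{0<..} \<times> UNIV :: (nat \<times> (int ^ 'd)) set"
  note cA = countable_scales[where ?'d = 'd]
  have cUA: "countable (UNIV \<times> ?A :: (nat \<times> nat \<times> (int ^ 'd)) set)" by simp
  define e where "e = (\<lambda>(n :: nat, i). case_prod (c n) i)"
  have "mass d \<le> (\<integral>\<^sup>+i. \<integral>\<^sup>+n. ennreal (norm (case_prod (c n) i) powr p) \<partial>count_space UNIV \<partial>count_space ?A)"
    unfolding lp_mass_def[of p ?A "case_prod d"]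
  proof (rule nn_integral_mono)
    fix i :: "nat \<times> (int ^ 'd)"
    show "ennreal (norm (case_prod d i) powr p) \<le> (\<integral>\<^sup>+n. ennreal (norm (case_prod (c n) i) powr p) \<partial>count_space UNIV)"
      using norm_infsum_powr_le[OF p, of "\<lambda>n. case_prod (c n) i" UNIV] by (simp add: d_def lp_mass_def split_beta')
  qed
  also have "\<dots> = (\<integral>\<^sup>+n. mass (c n) \<partial>count_space UNIV)"
    unfolding lp_mass_def by (rule nn_integral_count_space_nn_integral) auto
  also have "\<dots> = (\<Sum>n. mass (c n))" by (rule nn_integral_count_space_nat)
  finally show "mass d \<le> (\<Sum>n. mass (c n))" .
  show "adapted p a b \<Omega> \<psi> d"
    unfolding adapted_def
  proof (intro allI impI)
    fix j k assume j: "0 < j" and "d j k \<noteq> 0"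
    \<comment> \<open>A nonzero sum has a nonzero term, so adaptedness is inherited from the
      stages.\<close>
    then obtain n where "c n j k \<noteq> 0" unfolding d_def by (metis infsum_0)
    then show "ess_support (affine j k) \<subseteq> \<Omega>" using adm[of n] j by (simp add: admissible_def adapted_def)
  qed
  have "lp_mass p (UNIV \<times> ?A) e = (\<integral>\<^sup>+n. mass (c n) \<partial>count_space UNIV)"
    unfolding lp_mass_def by (subst nn_integral_count_space_Times) (simp_all add: cA e_def)
  then have fin: "lp_mass p (UNIV \<times> ?A) e < \<infinity>" using M by (simp add: nn_integral_count_space_nat)
  define u where "u x = (\<lambda>(n, i). case_prod (c n) i * affine (fst i) (snd i) x)" for x
  have u: "u x = (\<lambda>z. e z * affine (fst (snd z)) (snd (snd z)) x)" for x
    by (auto simp: u_def e_def fun_eq_iff)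
  have "(\<integral>\<^sup>+x. lp_mass p (UNIV \<times> ?A) (u x) \<partial>lebesgue) = lp_mass p (UNIV \<times> ?A) e * Lp_mass p \<psi>"
    unfolding u by (rule nn_integral_atoms(1)[OF cUA]) auto
  also have "\<dots> < \<infinity>" using fin \<psi>_mass by (simp add: ennreal_mult_less_top)
  \<comment> \<open>A finite integral makes the atoms of all stages together p-summable at almost
    every point, hence absolutely summable.\<close>
  finally have "(\<integral>\<^sup>+x. lp_mass p (UNIV \<times> ?A) (u x) \<partial>lebesgue) \<noteq> \<infinity>" by simp
  then have "AE x in lebesgue. lp_mass p (UNIV \<times> ?A) (u x) \<noteq> \<infinity>"
    unfolding u by (intro nn_integral_PInf_AE nn_integral_atoms(2)[OF cUA]) auto
  then show "AE x in lebesgue. (\<lambda>n. S (c n) x) sums S d x"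
  proof eventually_elim
    case (elim x)
    then have "lp_mass p (UNIV \<times> ?A) (u x) < \<infinity>" by (simp only: infinity_ennreal_def less_top)
    then have "u x summable_on (UNIV \<times> ?A)"
      by (rule abs_summable_summable[OF lp_mass_imp_abs_summable[OF p]])
    then have su: "(\<lambda>(n, i). case_prod (c n) i * affine (fst i) (snd i) x) summable_on (UNIV \<times> ?A)"
      by (simp add: u_def)
    have Sc: "S (c n) x = (\<Sum>\<^sub>\<infinity>i\<in>?A. case_prod (c n) i * affine (fst i) (snd i) x)" for n
      by (simp add: synthesis_def split_beta')
    have "(\<lambda>n. S (c n) x) summable_on UNIV"
      unfolding Sc using summable_on_SigmaD[OF su] summable_on_SigmaD1[OF su] by simp
    then have "((\<lambda>n. S (c n) x) has_sum (\<Sum>\<^sub>\<infinity>n. S (c n) x)) UNIV" by (rule has_sum_infsum)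
    also have "(\<Sum>\<^sub>\<infinity>n. S (c n) x) = (\<Sum>\<^sub>\<infinity>i\<in>?A. \<Sum>\<^sub>\<infinity>n. case_prod (c n) i * affine (fst i) (snd i) x)"
      unfolding Sc by (rule infsum_swap_banach[OF su])
    also have "\<dots> = S d x"
      by (simp add: synthesis_def split_beta' d_def infsum_cmult_left')
    finally show ?case by (rule has_sum_imp_sums)
  qed
qed

end

context affine_system_deviation
begin

text \<open>The masses of the stages are dominated by a geometric series with ratio (1 + t) / 2 and
  first term \<open>C + 1\<close> times the mass of f; its sum gives the constant.\<close>

lemma exact_synthesis:
  assumes f: "f \<in> borel_measurable lebesgue" "Lp_mass p f < \<infinity>" "AE x in lebesgue. x \<notin> \<Omega> \<longrightarrow> f x = 0"
  obtains c where "mass c \<le> ennreal ((C + 1) / (1 - (1 + t) / 2)) * Lp_mass p f"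
    "AE x in lebesgue. f x = S c x" "adapted p a b \<Omega> \<psi> c"
proof -
  define \<gamma> where "\<gamma> = (1 + t) / 2"
  have \<gamma>: "0 \<le> \<gamma>" "\<gamma> < 1" using t by (auto simp: \<gamma>_def)
  obtain m where m: "Lp_mass p f = ennreal m" "0 \<le> m" using f(2) by (cases "Lp_mass p f") auto
  define good where "good g \<longleftrightarrow> g \<in> borel_measurable lebesgue \<and> Lp_mass p g < \<infinity> \<and> (AE x in lebesgue. x \<notin> \<Omega> \<longrightarrow> g x = 0)" for g
  \<comment> \<open>A correction is chosen for every good function at once, so that the remainders
    can be defined by recursion.\<close>
  have "\<forall>g. \<exists>c. good g \<longrightarrow> admissible \<Omega> c \<and> Lp_mass p (\<lambda>x. g x - S c x) \<le> ennreal \<gamma> * Lp_mass p g \<and> mass c \<le> ennreal (C + 1) * Lp_mass p g"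
    unfolding good_def \<gamma>_def using approximation_step by blast
  from choice[OF this] obtain K where K': "\<forall>g. good g \<longrightarrow> admissible \<Omega> (K g) \<and>
      Lp_mass p (\<lambda>x. g x - S (K g) x) \<le> ennreal \<gamma> * Lp_mass p g \<and> mass (K g) \<le> ennreal (C + 1) * Lp_mass p g"
    by (rule exE)
  have K: "\<And>g. good g \<Longrightarrow> admissible \<Omega> (K g)"
    "\<And>g. good g \<Longrightarrow> Lp_mass p (\<lambda>x. g x - S (K g) x) \<le> ennreal \<gamma> * Lp_mass p g"
    "\<And>g. good g \<Longrightarrow> mass (K g) \<le> ennreal (C + 1) * Lp_mass p g"
    by (simp_all add: K'[rule_format])
  define F where "F = rec_nat f (\<lambda>n g x. g x - S (K g) x)"
  have F0: "F 0 = f" and FS: "F (Suc n) = (\<lambda>x. F n x - S (K (F n)) x)" for n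
    by (simp_all add: F_def)
  have F: "good (F n) \<and> Lp_mass p (F n) \<le> ennreal (\<gamma> ^ n * m)" for n
  proof (induction n)
    case 0
    then show ?case using f m by (simp add: F0 good_def)
  next
    case (Suc n)
    then have g: "good (F n)" by simp
    have "Lp_mass p (F (Suc n)) \<le> ennreal \<gamma> * Lp_mass p (F n)" unfolding FS by (rule K(2)[OF g])
    also have "\<dots> \<le> ennreal \<gamma> * ennreal (\<gamma> ^ n * m)" using Suc by (intro mult_left_mono) auto
    also have "\<dots> = ennreal (\<gamma> ^ Suc n * m)" using \<gamma> m by (simp add: ennreal_mult[symmetric] mult.assoc)
    finally have le: "Lp_mass p (F (Suc n)) \<le> ennreal (\<gamma> ^ Suc n * m)" .
    moreover have "F (Suc n) \<in> borel_measurable lebesgue"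
      unfolding FS using g measurable_S[OF K(1)[OF g]] by (intro borel_measurable_diff) (auto simp: good_def)
    moreover have "AE x in lebesgue. x \<notin> \<Omega> \<longrightarrow> F n x = 0" using g by (simp add: good_def)
    then have "AE x in lebesgue. x \<notin> \<Omega> \<longrightarrow> F (Suc n) x = 0"
      using AE_synthesis_zero[OF K(1)[OF g]] by eventually_elim (simp add: FS)
    ultimately show ?case
      using order_le_less_trans[OF le] by (simp add: good_def)
  qed
  have geo: "(\<Sum>n. ennreal (D * (\<gamma> ^ n * m))) = ennreal (D / (1 - \<gamma>) * m)" if "0 \<le> D" for D
  proof -
    have "(\<lambda>n. D * (\<gamma> ^ n * m)) sums (D * (1 / (1 - \<gamma>) * m))"
      using \<gamma> by (intro sums_mult sums_mult2 geometric_sums) auto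
    then show ?thesis
      using that \<gamma> m by (subst suminf_ennreal_eq) (auto intro!: mult_nonneg_nonneg)
  qed
  define c where "c n = K (F n)" for n
  have adm: "admissible \<Omega> (c n)" for n using K(1) F by (simp add: c_def)
  have "mass (c n) \<le> ennreal ((C + 1) * (\<gamma> ^ n * m))" for n
  proof -
    have "mass (c n) \<le> ennreal (C + 1) * Lp_mass p (F n)" using K(3) F by (simp add: c_def)
    also have "\<dots> \<le> ennreal (C + 1) * ennreal (\<gamma> ^ n * m)" using F by (intro mult_left_mono) auto
    also have "\<dots> = ennreal ((C + 1) * (\<gamma> ^ n * m))"
      using C_nonneg \<gamma> m by (intro ennreal_mult[symmetric]) auto
    finally show ?thesis .
  qed
  then have "(\<Sum>n. mass (c n)) \<le> (\<Sum>n. ennreal ((C + 1) * (\<gamma> ^ n * m)))"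
    by (intro suminf_le) auto
  then have M: "(\<Sum>n. mass (c n)) \<le> ennreal ((C + 1) / (1 - \<gamma>) * m)"
    using C_nonneg by (simp add: geo)
  define d where "d = (\<lambda>j k. \<Sum>\<^sub>\<infinity>n. c n j k)"
  note stages = synthesis_of_stages[OF adm order_le_less_trans[OF M], folded d_def]
  have [measurable]: "F n \<in> borel_measurable lebesgue" for n using F by (simp add: good_def)
  \<comment> \<open>Summability of the masses, rather than mere convergence to 0, yields
    \<open>F n x \<longlonglongrightarrow> 0\<close> for almost every x along the whole sequence,
    with no passage to a subsequence.\<close>
  have "(\<integral>\<^sup>+x. lp_mass p UNIV (\<lambda>n. F n x) \<partial>lebesgue) = (\<Sum>n. Lp_mass p (F n))"
    unfolding lp_mass_def Lp_mass_def
    by (subst nn_integral_count_space_nn_integral) (auto simp: nn_integral_count_space_nat)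
  also have "\<dots> \<le> (\<Sum>n. ennreal (1 * (\<gamma> ^ n * m)))" using F by (intro suminf_le) auto
  also have "\<dots> < \<infinity>" by (subst geo) auto
  finally have "(\<integral>\<^sup>+x. lp_mass p UNIV (\<lambda>n. F n x) \<partial>lebesgue) \<noteq> \<infinity>" by simp
  then have "AE x in lebesgue. lp_mass p UNIV (\<lambda>n. F n x) \<noteq> \<infinity>"
    unfolding lp_mass_def by (intro nn_integral_PInf_AE borel_measurable_nn_integral_count_space) auto
  moreover have "AE x in lebesgue. (\<lambda>n. S (c n) x) sums S d x" using stages(2) by simp
  ultimately have "AE x in lebesgue. f x = S d x"
  proof eventually_elim
    case (elim x)
    have "(\<lambda>n. norm (F n x)) summable_on UNIV"
      using elim(1) by (intro lp_mass_imp_abs_summable[OF p]) (simp only: infinity_ennreal_def less_top)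
    then have "(\<lambda>n. norm (F n x)) \<longlonglongrightarrow> 0" by (intro summable_LIMSEQ_zero summable_on_imp_summable)
    then have "(\<lambda>n. f x - F n x) \<longlonglongrightarrow> f x - 0" by (intro tendsto_intros) (simp add: tendsto_norm_zero_iff)
    moreover have "f x - F n x = (\<Sum>i<n. S (c i) x)" for n
      by (induction n) (simp_all add: F0 FS c_def algebra_simps)
    ultimately have "(\<lambda>n. S (c n) x) sums f x" by (simp add: sums_def)
    then show ?case using elim(2) by (rule sums_unique2)
  qed
  moreover have "mass d \<le> ennreal ((C + 1) / (1 - (1 + t) / 2)) * Lp_mass p f"
  proof -
    have "mass d \<le> ennreal ((C + 1) / (1 - \<gamma>) * m)" using stages(1) M by (auto intro: order_trans)
    also have "\<dots> = ennreal ((C + 1) / (1 - \<gamma>)) * ennreal m"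
      using C_nonneg \<gamma> m by (intro ennreal_mult) auto
    finally show ?thesis by (simp add: m \<gamma>_def)
  qed
  ultimately show ?thesis using stages(3) by (intro that[of d]) auto
qed

end

section \<open>Hypotheses and quasi-norms of the theorem in terms of masses\<close>

lemma periodization_lattice_sum:
  "periodization b \<psi> (b *v x) = of_real \<bar>det b\<bar> * lattice_sum (\<lambda>y. \<psi> (b *v y)) x"
  by (simp add: periodization_def lattice_sum_def matrix_vector_mult_diff_distrib)

lemma nn_integral_cube_deviation_less_1:
  assumes p: "0 < p" "p \<le> 1"
    and supp: "AE x in lebesgue. R < norm x \<longrightarrow> \<phi> x = 0"
    and meas: "\<phi> \<in> borel_measurable lebesgue" and mass: "Lp_mass p \<phi> < \<infinity>"
    and less: "Lp_norm p unit_cube (\<lambda>x. \<mu> * lattice_sum \<phi> x - 1) < 1"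
  shows "(\<integral>\<^sup>+x. cube_deviation p \<mu> \<phi> x \<partial>lebesgue) < 1"
proof -
  define g where "g x = indicator unit_cube x *\<^sub>R norm (\<mu> * lattice_sum \<phi> x - 1) powr p" for x
  have eg: "ennreal (g x) = cube_deviation p \<mu> \<phi> x" for x
    by (simp add: g_def cube_deviation_def indicator_def norm_minus_commute)
  have g0: "0 \<le> g x" for x by (simp add: g_def)
  have "g = (\<lambda>x. enn2real (cube_deviation p \<mu> \<phi> x))"
    using g0 by (simp add: eg[symmetric] fun_eq_iff)
  then have gm: "g \<in> borel_measurable lebesgue"
    using measurable_cube_deviation[OF supp meas, of p \<mu>] by simp
  \<comment> \<open>Rules out that the Bochner integral is below 1 only through its default value
    0.\<close>
  have fin: "(\<integral>\<^sup>+x. cube_deviation p \<mu> \<phi> x \<partial>lebesgue) < \<infinity>"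
    by (rule nn_integral_cube_deviation_finite[OF p supp meas mass])
  have int: "(LINT x|lebesgue. g x) = enn2real (\<integral>\<^sup>+x. cube_deviation p \<mu> \<phi> x \<partial>lebesgue)"
    using gm g0 by (subst integral_eq_nn_integral) (auto simp: eg)
  have "(LINT x|lebesgue. g x) powr (1 / p) < 1"
    using less by (simp add: Lp_norm_def set_lebesgue_integral_def g_def)
  then have "(LINT x|lebesgue. g x) < 1"
    using ge_one_powr_ge_zero[of "LINT x|lebesgue. g x" "1 / p"] p by (meson not_less divide_nonneg_pos zero_le_one)
  then show ?thesis unfolding int
    using fin by (cases "\<integral>\<^sup>+x. cube_deviation p \<mu> \<phi> x \<partial>lebesgue") auto
qed

lemma Lp_space_zero_extension:
  assumes "f \<in> Lp_space p \<Omega>" "0 < p"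
  shows "zero_extension \<Omega> f \<in> borel_measurable lebesgue"
    and "Lp_mass p (zero_extension \<Omega> f) < \<infinity>"
    and "Lp_norm p \<Omega> f = enn2real (Lp_mass p (zero_extension \<Omega> f)) powr (1 / p)"
proof -
  have eq: "zero_extension \<Omega> f = (\<lambda>x. indicator \<Omega> x *\<^sub>R f x)"
    by (auto simp: zero_extension_def fun_eq_iff)
  have eqn: "indicator \<Omega> x *\<^sub>R norm (f x) powr p = norm (zero_extension \<Omega> f x) powr p" for x
    by (simp add: zero_extension_def)
  show m [measurable]: "zero_extension \<Omega> f \<in> borel_measurable lebesgue"
    unfolding eq using assms(1) by (simp add: Lp_space_def set_borel_measurable_def)
  have int: "integrable lebesgue (\<lambda>x. norm (zero_extension \<Omega> f x) powr p)"
  proof -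
    have "set_integrable lebesgue \<Omega> (\<lambda>x. norm (f x) powr p)" using assms(1) by (simp add: Lp_space_def)
    then show ?thesis unfolding set_integrable_def eqn .
  qed
  then show "Lp_mass p (zero_extension \<Omega> f) < \<infinity>"
    unfolding integrable_iff_bounded Lp_mass_def by simp
  show "Lp_norm p \<Omega> f = enn2real (Lp_mass p (zero_extension \<Omega> f)) powr (1 / p)"
    unfolding Lp_norm_def set_lebesgue_integral_def eqn Lp_mass_def
    by (subst integral_eq_nn_integral) auto
qed

lemma ess_support_compact_radius:
  fixes b :: "real ^ 'd ^ 'd"
  assumes "invertible b" "compact (ess_support \<psi>)"
  obtains R where "0 \<le> R" "AE x in lebesgue. R < norm x \<longrightarrow> \<psi> (b *v x) = 0"
proof -
  obtain L where L: "0 < L" "\<And>x. x \<in> ess_support \<psi> \<Longrightarrow> norm x \<le> L"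
    using compact_imp_bounded[OF assms(2)] by (auto simp: bounded_pos)
  have bl: "bounded_linear ((*v) (matrix_inv b))" by simp
  define R where "R = onorm ((*v) (matrix_inv b)) * L"
  have "0 \<le> R" unfolding R_def using L(1) by (intro mult_nonneg_nonneg onorm_pos_le[OF bl]) auto
  moreover have "AE x in lebesgue. R < norm x \<longrightarrow> \<psi> (b *v x) = 0"
    using AE_matrix_vector_mult[OF assms(1) AE_not_in_ess_support[of \<psi>]]
  proof eventually_elim
    case (elim x)
    show ?case
    proof
      assume x: "R < norm x"
      have "b *v x \<notin> ess_support \<psi>"
      proof
        assume "b *v x \<in> ess_support \<psi>"
        then have "onorm ((*v) (matrix_inv b)) * norm (b *v x) \<le> R"
          unfolding R_def by (intro mult_left_mono L onorm_pos_le[OF bl])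
        then show False
          using x onorm[OF bl, of "b *v x"] by (simp add: matrix_inv_vector_mult[OF assms(1)])
      qed
      then show "\<psi> (b *v x) = 0" using elim by simp
    qed
  qed
  ultimately show ?thesis by (rule that)
qed

theorem corollary8:
  fixes p :: real
    and b :: "real ^ 'd ^ 'd"
    and \<psi> :: "real ^ 'd \<Rightarrow> complex"
  assumes "0 < p" and "p \<le> 1"
    and "invertible b"
    and "\<psi> \<in> Lp_space p UNIV"
    and "compact (ess_support \<psi>)"
    and "\<exists>z::complex. Lp_norm p unit_cube (\<lambda>x. z * periodization b \<psi> (b *v x) - 1) < 1"
  shows "\<exists>C1>0. \<exists>C2>0.
    \<forall>(a :: nat \<Rightarrow> real ^ 'd ^ 'd) (\<Omega> :: (real ^ 'd) set) (f :: real ^ 'd \<Rightarrow> complex).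
      (\<forall>j>0. invertible (a j)) \<longrightarrow>
      (\<lambda>j. onorm (\<lambda>x. matrix_inv (a j) *v x)) \<longlonglongrightarrow> 0 \<longrightarrow>
      open \<Omega> \<longrightarrow> \<Omega> \<noteq> {} \<longrightarrow> f \<in> Lp_space p \<Omega> \<longrightarrow>
      (let I = (INF c \<in> {c \<in> lp_space p.
                   (AE x in lebesgue. zero_extension \<Omega> f x = synthesis p a b \<psi> c x) \<and>
                   adapted p a b \<Omega> \<psi> c}. ereal (lp_norm p c))
       in ereal (C1 * Lp_norm p \<Omega> f) \<le> I \<and> I \<le> ereal (C2 * Lp_norm p \<Omega> f))"
proof -
  note p = assms(1,2) and b = assms(3)
  have "zero_extension UNIV \<psi> = \<psi>" by (simp add: zero_extension_def)
  then have \<psi>: "\<psi> \<in> borel_measurable lebesgue" "Lp_mass p \<psi> < \<infinity>"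
    using Lp_space_zero_extension[OF assms(4) p(1)] by simp_all
  obtain R where R: "0 \<le> R" "AE x in lebesgue. R < norm x \<longrightarrow> \<psi> (b *v x) = 0"
    using ess_support_compact_radius[OF b assms(5)] .
  obtain z where z: "Lp_norm p unit_cube (\<lambda>x. z * periodization b \<psi> (b *v x) - 1) < 1"
    using assms(6) by blast
  \<comment> \<open>\<mu> absorbs the determinant factor of \<open>periodization\<close>, so that
    the hypothesis speaks of \<open>\<mu> * lattice_sum\<close>.\<close>
  define \<mu> where "\<mu> = z * of_real \<bar>det b\<bar>"
  define dev where "dev = (\<integral>\<^sup>+x. cube_deviation p \<mu> (\<lambda>y. \<psi> (b *v y)) x \<partial>lebesgue)"
  have "dev < 1"
    unfolding dev_def
  proof (rule nn_integral_cube_deviation_less_1[OF p R(2)])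
    show "(\<lambda>y. \<psi> (b *v y)) \<in> borel_measurable lebesgue"
      using measurable_compose[OF measurable_matrix_vector_mult_lebesgue[OF b] \<psi>(1)] .
    show "Lp_mass p (\<lambda>y. \<psi> (b *v y)) < \<infinity>"
      using \<psi>(2) by (simp add: Lp_mass_matrix_vector_mult[OF b \<psi>(1)] ennreal_mult_less_top)
    show "Lp_norm p unit_cube (\<lambda>x. \<mu> * lattice_sum (\<lambda>y. \<psi> (b *v y)) x - 1) < 1"
      using z by (simp add: \<mu>_def periodization_lattice_sum mult.assoc)
  qed
  then obtain t where t: "dev = ennreal t" "0 \<le> t" "t < 1" by (cases dev) auto
  define C where "C = norm \<mu> powr p / \<bar>det b\<bar>"
  define D where "D = (C + 1) / (1 - (1 + t) / 2)"
  have "0 \<le> C" by (simp add: C_def)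
  then have D: "0 < D" using t by (simp add: D_def)
  \<comment> \<open>The quasi-norm of \<psi>. Like \<open>D\<close>, it is fixed before
    \<open>a\<close>, \<Omega> and f are introduced, which gives the uniformity of the
    constants.\<close>
  define q where "q = enn2real (Lp_mass p \<psi>) powr (1 / p)"
  have q: "0 \<le> q" by (simp add: q_def)
  show ?thesis
  proof (intro exI conjI allI impI)
    \<comment> \<open>Using \<open>q + 1\<close> in place of \<open>q\<close> spares the proof that
      \<psi> is not null.\<close>
    show "0 < 1 / (q + 1)" using q by simp
    show "0 < D powr (1 / p)" using D by simp
    fix a :: "nat \<Rightarrow> real ^ 'd ^ 'd" and \<Omega> :: "(real ^ 'd) set" and f :: "real ^ 'd \<Rightarrow> complex"
    assume a: "\<forall>j>0. invertible (a j)" "(\<lambda>j. onorm (\<lambda>x. matrix_inv (a j) *v x)) \<longlonglongrightarrow> 0"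
      and \<Omega>: "open \<Omega>" and f: "f \<in> Lp_space p \<Omega>"
    interpret affine_system p a b \<psi> R
      using p b \<psi> R a by unfold_locales auto
    have \<phi>_eq: "\<phi> = (\<lambda>y. \<psi> (b *v y))" by (simp add: \<phi>_def fun_eq_iff)
    interpret affine_system_deviation p a b \<psi> R \<mu> t C \<Omega>
      using t \<Omega> by unfold_locales (auto simp: \<phi>_eq dev_def C_def)
    let ?g = "zero_extension \<Omega> f"
    note g = Lp_space_zero_extension[OF f p(1)]
    let ?A = "{c \<in> lp_space p. (AE x in lebesgue. ?g x = S c x) \<and> adapted p a b \<Omega> \<psi> c}"
    let ?I = "INF c\<in>?A. ereal (lp_norm p c)"
    have "ereal (1 / (q + 1) * Lp_norm p \<Omega> f) \<le> ?I"
    proof (rule INF_greatest)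
      fix c assume c: "c \<in> ?A"
      then have cl: "c \<in> lp_space p" by simp
      then have "mass c < \<infinity>" by (simp add: lp_space_iff_mass)
      then have fin: "mass c * Lp_mass p \<psi> < top" using \<psi>(2) by (simp add: ennreal_mult_less_top)
      have "Lp_mass p ?g = Lp_mass p (S c)" using c by (intro Lp_mass_cong_AE) auto
      also have "\<dots> \<le> mass c * Lp_mass p \<psi>" by (rule Lp_mass_synthesis_le)
      finally have "enn2real (Lp_mass p ?g) \<le> enn2real (mass c) * enn2real (Lp_mass p \<psi>)"
        using enn2real_mono[OF _ fin] by (simp add: enn2real_mult)
      then have "Lp_norm p \<Omega> f \<le> (enn2real (mass c) * enn2real (Lp_mass p \<psi>)) powr (1 / p)"
        unfolding g(3) using p by (intro powr_mono2) auto
      also have "\<dots> = lp_norm p c * q"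
        by (simp add: powr_mult lp_norm_eq_mass[OF cl] q_def)
      also have "\<dots> \<le> lp_norm p c * (q + 1)"
        by (intro mult_left_mono) (auto simp: lp_norm_eq_mass[OF cl])
      finally show "ereal (1 / (q + 1) * Lp_norm p \<Omega> f) \<le> ereal (lp_norm p c)"
        using q by (simp add: field_simps)
    qed
    moreover have "?I \<le> ereal (D powr (1 / p) * Lp_norm p \<Omega> f)"
    proof -
      \<comment> \<open>A single representation bounds the infimum, which over an empty set would be
        \<infinity>.\<close>
      obtain c where c: "mass c \<le> ennreal D * Lp_mass p ?g" "AE x in lebesgue. ?g x = S c x" "adapted p a b \<Omega> \<psi> c"
        using exact_synthesis[OF g(1,2)] unfolding D_def by (auto simp: zero_extension_def)
      have fin: "ennreal D * Lp_mass p ?g < top" using g(2) by (simp add: ennreal_mult_less_top)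
      then have "mass c < \<infinity>" using c(1) by (simp add: order_le_less_trans)
      then have cl: "c \<in> lp_space p" by (simp add: lp_space_iff_mass)
      have "enn2real (mass c) \<le> D * enn2real (Lp_mass p ?g)"
        using enn2real_mono[OF c(1) fin] D by (simp add: enn2real_mult)
      then have "lp_norm p c \<le> (D * enn2real (Lp_mass p ?g)) powr (1 / p)"
        unfolding lp_norm_eq_mass[OF cl] using p by (intro powr_mono2) auto
      also have "\<dots> = D powr (1 / p) * Lp_norm p \<Omega> f"
        unfolding g(3) using D by (simp add: powr_mult)
      finally show ?thesis using c cl by (intro INF_lower2[of c]) auto
    qed
    ultimately show "let I = ?I in ereal (1 / (q + 1) * Lp_norm p \<Omega> f) \<le> I \<and> I \<le> ereal (D powr (1 / p) * Lp_norm p \<Omega> f)"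
      by (simp add: Let_def)
  qed
qed

end
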